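(* The functors $\mathcal{K}$ and $\mathcal{X}$ induce a one-to-one correspondence between simple equivalence classes of finite $T_0$-spaces and simple homotopy types of finite simplicial complexes: the assignments $[X] \mapsto [\mathcal{K}(X)]$ and $[K] \mapsto [\mathcal{X}(K)]$ are well defined and mutually inverse.
   Context: Finite $T_0$-spaces are identified with finite posets: $x \le y$ iff $x \in U_y$, where $U_y = \{x : x \le y\}$ is the minimal open set of $y$; the closure $\overline{\{y\}}$ is $\{x : x \ge y\}$. A point $x$ of a finite $T_0$-space $X$ is a weak point if $U_x \smallsetminus \{x\}$ is contractible or $\overline{\{x\}} \smallsetminus \{x\}$ is contractible. $X$ collapses to $Y$, written $X \searrow Y$ or $Y \nearrow X$, if $Y$ is obtained from $X$ by successively removing finitely many points, each a weak point of the space from which it is removed. $X$ and $Y$ are simply equivalent if there is a finite sequence $X = X_1, \dots, X_n = Y$ of finite $T_0$-spaces with $X_i \searrow X_{i+1}$ or $X_i \nearrow X_{i+1}$ for each $1\le i<n$. There is an elementary simplicial collapse from $K$ to $L$ if there are a simplex $S$ of $K$ and a vertex $a$ of $K$ not in $S$ with $K = L \cup aS$ and $L \cap aS = a\dot{S}$ ($aS$ the simplex spanned by $a$ and $S$ together with its faces, $\dot S$ the boundary of $S$); $K \searrow L$ (equivalently $L \nearrow K$) means there is a finite sequence of elementary simplicial collapses from $K$ to $L$. Finite simplicial complexes $K$ and $L$ have the same simple homotopy type if there is a finite sequence $K = K_1, \dots, K_n = L$ of finite simplicial complexes with $K_i \searrow K_{i+1}$ or $K_i \nearrow K_{i+1}$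 for each $1\le i<n$. $\mathcal{K}(X)$ is the simplicial complex of non-empty chains of the finite $T_0$-space $X$. $\mathcal{X}(K)$ is the finite $T_0$-space given by the poset of (non-empty) simplices of $K$ ordered by inclusion. Brackets denote the classes under simple equivalence, respectively under having the same simple homotopy type. *)

theory Defs
  imports "HOL-Analysis.Analysis"
begin

section \<open>Finite $T_0$-spaces\<close>

definition finite_t0_space :: "'a topology \<Rightarrow> bool" where
  "finite_t0_space X \<longleftrightarrow> finite (topspace X) \<and> t0_space X"

definition min_open :: "'a topology \<Rightarrow> 'a \<Rightarrow> 'a set" where
  "min_open X x = \<Inter>{U. openin X U \<and> x \<in> U}"

definition point_le :: "'a topology \<Rightarrow> 'a \<Rightarrow> 'a \<Rightarrow> bool" where
  "point_le X x y \<longleftrightarrow> x \<in> min_open X y"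

text \<open>The library's \<^const>\<open>contractible_space\<close> holds for the empty space; here a
  contractible space is homotopy equivalent to a point and hence non-empty.\<close>

definition weak_point :: "'a topology \<Rightarrow> 'a \<Rightarrow> bool" where
  "weak_point X x \<longleftrightarrow> x \<in> topspace X \<and>
     (min_open X x - {x} \<noteq> {} \<and> contractible_space (subtopology X (min_open X x - {x})) \<or>
      X closure_of {x} - {x} \<noteq> {} \<and> contractible_space (subtopology X (X closure_of {x} - {x})))"

definition elementary_space_collapse :: "'a topology \<Rightarrow> 'a topology \<Rightarrow> bool" where
  "elementary_space_collapse X Y \<longleftrightarrow> finite_t0_space X \<and>
     (\<exists>x. weak_point X x \<and> Y = subtopology X (topspace X - {x}))"

definition space_collapse :: "'a topology \<Rightarrow> 'a topology \<Rightarrow> bool" where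
  "space_collapse = elementary_space_collapse\<^sup>*\<^sup>*"

definition space_step :: "'a topology \<Rightarrow> 'a topology \<Rightarrow> bool" where
  "space_step X Y \<longleftrightarrow> finite_t0_space X \<and> finite_t0_space Y \<and>
     (space_collapse X Y \<or> space_collapse Y X)"

text \<open>
  The points of the intermediate spaces of a simple equivalence are arbitrary, and the two spaces
  to be compared may have different point types (such as \<^typ>\<open>'a\<close> and \<^typ>\<open>'a set\<close>). As usual,
  spaces are considered up to homeomorphism, so a sequence is taken among spaces of natural
  numbers, which represent all finite spaces and always leave room for new points.
\<close>

definition simply_equivalent :: "'a topology \<Rightarrow> 'b topology \<Rightarrow> bool" where
  "simply_equivalent X Y \<longleftrightarrow> finite_t0_space X \<and> finite_t0_space Y \<and>
     (\<exists>X' Y' :: nat topology. X homeomorphic_space X' \<and> space_step\<^sup>*\<^sup>* X' Y' \<and>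
        Y' homeomorphic_space Y)"

section \<open>Finite simplicial complexes\<close>

text \<open>A complex is the set of its (non-empty) simplices; its vertex set is \<^term>\<open>\<Union>K\<close>.\<close>

definition finite_complex :: "'a set set \<Rightarrow> bool" where
  "finite_complex K \<longleftrightarrow> finite K \<and> (\<forall>S\<in>K. finite S \<and> S \<noteq> {}) \<and>
     (\<forall>S\<in>K. \<forall>T. T \<subseteq> S \<and> T \<noteq> {} \<longrightarrow> T \<in> K)"

definition complex_iso :: "'a set set \<Rightarrow> 'b set set \<Rightarrow> bool" where
  "complex_iso K L \<longleftrightarrow> (\<exists>f. bij_betw f (\<Union>K) (\<Union>L) \<and> L = (\<lambda>S. f ` S) ` K)"

definition simplex_faces :: "'a set \<Rightarrow> 'a set set" where
  "simplex_faces S = {T. T \<subseteq> S \<and> T \<noteq> {}}"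

definition simplex_boundary :: "'a set \<Rightarrow> 'a set set" where
  "simplex_boundary S = simplex_faces S - {S}"

definition cone :: "'a \<Rightarrow> 'a set set \<Rightarrow> 'a set set" where
  "cone a M = insert {a} (M \<union> insert a ` M)"

definition elementary_simplicial_collapse :: "'a set set \<Rightarrow> 'a set set \<Rightarrow> bool" where
  "elementary_simplicial_collapse K L \<longleftrightarrow> finite_complex K \<and> finite_complex L \<and>
     (\<exists>S a. S \<in> K \<and> a \<in> \<Union>K \<and> a \<notin> S \<and>
        K = L \<union> simplex_faces (insert a S) \<and>
        L \<inter> simplex_faces (insert a S) = cone a (simplex_boundary S))"

definition simplicial_collapse :: "'a set set \<Rightarrow> 'a set set \<Rightarrow> bool" where
  "simplicial_collapse = elementary_simplicial_collapse\<^sup>*\<^sup>*"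

definition complex_step :: "'a set set \<Rightarrow> 'a set set \<Rightarrow> bool" where
  "complex_step K L \<longleftrightarrow> finite_complex K \<and> finite_complex L \<and>
     (simplicial_collapse K L \<or> simplicial_collapse L K)"

text \<open>Complexes are considered up to isomorphism, in the same way as spaces above.\<close>

definition same_simple_homotopy_type :: "'a set set \<Rightarrow> 'b set set \<Rightarrow> bool" where
  "same_simple_homotopy_type K L \<longleftrightarrow> finite_complex K \<and> finite_complex L \<and>
     (\<exists>K' L' :: nat set set. complex_iso K K' \<and> complex_step\<^sup>*\<^sup>* K' L' \<and> complex_iso L' L)"

section \<open>Order complex and face poset\<close>

definition order_complex :: "'a topology \<Rightarrow> 'a set set" where
  "order_complex X =
     {C. C \<subseteq> topspace X \<and> C \<noteq> {} \<and> Complete_Partial_Order.chain (point_le X) C}"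

text \<open>The open sets are the down-sets, so that \<^term>\<open>point_le (face_space K)\<close> is inclusion on
  the simplices of \<^term>\<open>K\<close>.\<close>

definition face_space :: "'a set set \<Rightarrow> 'a set topology" where
  "face_space K = topology (\<lambda>U. U \<subseteq> K \<and> (\<forall>S\<in>U. \<forall>T\<in>K. T \<subseteq> S \<longrightarrow> T \<in> U))"

lemma openin_face_space:
  "openin (face_space K) U \<longleftrightarrow> U \<subseteq> K \<and> (\<forall>S\<in>U. \<forall>T\<in>K. T \<subseteq> S \<longrightarrow> T \<in> U)"
proof -
  have "istopology (\<lambda>U. U \<subseteq> K \<and> (\<forall>S\<in>U. \<forall>T\<in>K. T \<subseteq> S \<longrightarrow> T \<in> U))"
    unfolding istopology_def by blast
  then show ?thesis
    by (simp add: face_space_def)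
qed

lemma topspace_face_space [simp]: "topspace (face_space K) = K"
  unfolding topspace_def openin_face_space by blast

lemma point_le_face_space:
  assumes "S \<in> K" "T \<in> K"
  shows "point_le (face_space K) S T \<longleftrightarrow> S \<subseteq> T"
proof
  have "openin (face_space K) {R \<in> K. R \<subseteq> T}"
    by (auto simp: openin_face_space)
  moreover assume "point_le (face_space K) S T"
  ultimately show "S \<subseteq> T"
    using assms by (auto simp: point_le_def min_open_def)
next
  assume "S \<subseteq> T"
  then show "point_le (face_space K) S T"
    using assms by (auto simp: point_le_def min_open_def openin_face_space)
qed

section \<open>Classes\<close>

text \<open>A class is represented by its members on natural numbers, whatever the type of the given
  representative; every finite space and every finite complex is isomorphic to such a member.\<close>

definition space_class :: "'a topology \<Rightarrow> nat topology set" where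
  "space_class X = {Y. simply_equivalent X Y}"

definition complex_class :: "'a set set \<Rightarrow> nat set set set" where
  "complex_class K = {L. same_simple_homotopy_type K L}"

definition simple_equivalence_classes :: "nat topology set set" where
  "simple_equivalence_classes = space_class ` {X :: nat topology. finite_t0_space X}"

definition simple_homotopy_types :: "nat set set set set" where
  "simple_homotopy_types = complex_class ` {K :: nat set set. finite_complex K}"

end

theory Submission
  imports Defs
begin

text \<open>
  Removing a weak point \<open>x\<close> of \<open>X\<close> collapses \<open>\<K>(X)\<close>: the link of \<open>x\<close> is the join of the chains
  below and above \<open>x\<close>, and a contractible finite space can be dismantled by removing beat points
  (Stong), which removes the simplices through \<open>x\<close> in stars whose links are cones. Conversely an
  elementary collapse of \<open>K\<close> removes two weak points of \<open>\<X>(K)\<close>. Finally \<open>X\<close> and \<open>\<X>(\<K>(X))\<close> are both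
  obtained from one mapping cylinder by removing weak points, and \<open>K\<close> and \<open>\<K>(\<X>(K))\<close> are both
  obtained from one simplicial mapping cylinder by collapsing.
\<close>

section \<open>Finite spaces as posets\<close>

text \<open>Weak points are defined by topological contractibility, while collapses of complexes are
  combinatorial. The bridge is rigidity: without beat points, a continuous self-map that is
  pointwise comparable with the identity is the identity. A beat point of either kind is a dominated
  vertex of the comparability graph, and the order complex is the clique complex of that graph.
  Hence dismantling is defined for an arbitrary relation, and both kinds of weak point are one case.
  Where points have to be shown weak, contractibility always comes from a monotone \<open>f\<close>
  with \<open>x \<le> f x\<close> and \<open>p \<le> f x\<close>.

  A second obstacle is that sequences of steps run through copies on the natural numbers. Two
  sequences to be joined meet only up to isomorphism, and later expansions may add points that this
  isomorphism does not cover. Transitivity therefore rests on moving a whole sequence along an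
  injection that is extended to fresh numbers before each step.

  Mapping cylinders are used because an object and its subdivision have different point types and
  neither lies inside the other.\<close>

lemma finite_t0_spaceD:
  assumes "finite_t0_space X"
  shows "finite (topspace X)" "t0_space X"
  using assms by (auto simp: finite_t0_space_def)

lemma finite_t0_space_subtopology:
  "finite_t0_space X \<Longrightarrow> finite_t0_space (subtopology X S)"
  by (simp add: finite_t0_space_def t0_space_subtopology)

lemma min_open_subset: "openin X U \<Longrightarrow> x \<in> U \<Longrightarrow> min_open X x \<subseteq> U"
  by (auto simp: min_open_def)

lemma point_le_refl: "point_le X x x"
  by (simp add: point_le_def min_open_def)

lemma point_le_trans: "point_le X x y \<Longrightarrow> point_le X y z \<Longrightarrow> point_le X x z"
  by (auto simp: point_le_def min_open_def)

text \<open>Finiteness enters here: there are only finitely many open sets, so the intersection of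
  all those containing \<open>x\<close> is a finite one.\<close>

lemma openin_min_open:
  assumes "finite_t0_space X" "x \<in> topspace X"
  shows "openin X (min_open X x)"
proof -
  have "{U. openin X U \<and> x \<in> U} \<subseteq> Pow (topspace X)"
    using openin_subset by auto
  then have "finite {U. openin X U \<and> x \<in> U}"
    using assms finite_t0_spaceD(1) finite_subset by blast
  moreover have "{U. openin X U \<and> x \<in> U} \<noteq> {}"
    using assms by auto
  ultimately show ?thesis
    unfolding min_open_def by (intro openin_Inter) auto
qed

lemma min_open_eq:
  assumes "finite_t0_space X" "x \<in> topspace X"
  shows "min_open X x = {y \<in> topspace X. point_le X y x}"
  using openin_subset[OF openin_min_open[OF assms]] by (auto simp: point_le_def)

text \<open>A down-set is the union of the minimal open sets of its points.\<close>

lemma openin_iff_down_closed: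
  assumes "finite_t0_space X"
  shows "openin X U \<longleftrightarrow>
    U \<subseteq> topspace X \<and> (\<forall>y\<in>U. \<forall>x\<in>topspace X. point_le X x y \<longrightarrow> x \<in> U)"
proof
  assume U: "openin X U"
  show "U \<subseteq> topspace X \<and> (\<forall>y\<in>U. \<forall>x\<in>topspace X. point_le X x y \<longrightarrow> x \<in> U)"
    using openin_subset[OF U] min_open_subset[OF U] by (auto simp: point_le_def)
next
  assume U: "U \<subseteq> topspace X \<and> (\<forall>y\<in>U. \<forall>x\<in>topspace X. point_le X x y \<longrightarrow> x \<in> U)"
  have "\<exists>T. openin X T \<and> x \<in> T \<and> T \<subseteq> U" if "x \<in> U" for x
    using that U openin_min_open[OF assms, of x] min_open_eq[OF assms, of x] point_le_refl[of X x]
    by (intro exI[of _ "min_open X x"]) auto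
  then show "openin X U"
    by (subst openin_subopen) blast
qed

lemma point_le_antisym:
  assumes "finite_t0_space X" "x \<in> topspace X" "y \<in> topspace X"
    "point_le X x y" "point_le X y x"
  shows "x = y"
proof (rule ccontr)
  assume "x \<noteq> y"
  then obtain U where "openin X U" "x \<notin> U \<longleftrightarrow> y \<in> U"
    using finite_t0_spaceD(2)[OF assms(1)] assms(2,3) by (auto simp: t0_space_def)
  then show False
    using assms(4,5) by (auto simp: point_le_def min_open_def)
qed

lemma point_le_subtopology:
  assumes "finite_t0_space X" "x \<in> topspace X \<inter> S" "y \<in> topspace X \<inter> S"
  shows "point_le (subtopology X S) x y \<longleftrightarrow> point_le X x y"
proof -
  have "point_le (subtopology X S) x y \<longleftrightarrow> (\<forall>U. openin X U \<and> y \<in> U \<longrightarrow> x \<in> U)"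
    using assms by (auto simp: point_le_def min_open_def openin_subtopology)
  then show ?thesis
    by (auto simp: point_le_def min_open_def)
qed

lemma closure_of_eq_upper:
  assumes "finite_t0_space X" "x \<in> topspace X"
  shows "X closure_of {x} = {y \<in> topspace X. point_le X x y}"
proof -
  have "point_le X x y \<longleftrightarrow> (\<forall>U. y \<in> U \<and> openin X U \<longrightarrow> x \<in> U)" for y
    by (auto simp: point_le_def min_open_def)
  then show ?thesis
    by (simp add: closure_of_def)
qed

text \<open>For a point of a finite T0-space, this set and \<open>strict_upper\<close> are the two
  punctured sets in the definition of a weak point, described through the order (see
  \<open>weak_point_iff\<close>).\<close>

definition strict_lower :: "'a topology \<Rightarrow> 'a \<Rightarrow> 'a set" where
  "strict_lower X x = {y \<in> topspace X. y \<noteq> x \<and> point_le X y x}"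

definition strict_upper :: "'a topology \<Rightarrow> 'a \<Rightarrow> 'a set" where
  "strict_upper X x = {y \<in> topspace X. y \<noteq> x \<and> point_le X x y}"

lemma weak_point_iff:
  assumes "finite_t0_space X"
  shows "weak_point X x \<longleftrightarrow> x \<in> topspace X \<and>
    (strict_lower X x \<noteq> {} \<and> contractible_space (subtopology X (strict_lower X x)) \<or>
     strict_upper X x \<noteq> {} \<and> contractible_space (subtopology X (strict_upper X x)))"
proof (cases "x \<in> topspace X")
  case True
  have "min_open X x - {x} = strict_lower X x" "X closure_of {x} - {x} = strict_upper X x"
    using min_open_eq[OF assms True] closure_of_eq_upper[OF assms True]
    by (auto simp: strict_lower_def strict_upper_def)
  then show ?thesis
    using True by (simp add: weak_point_def)
qed (simp add: weak_point_def)

section \<open>Continuous maps as monotone maps, and extremal points\<close>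

lemma monotone_imp_continuous:
  assumes X: "finite_t0_space X" and Y: "finite_t0_space Y"
    and "f \<in> topspace X \<rightarrow> topspace Y"
    and "\<And>x y. x \<in> topspace X \<Longrightarrow> y \<in> topspace X \<Longrightarrow> point_le X x y \<Longrightarrow> point_le Y (f x) (f y)"
  shows "continuous_map X Y f"
  unfolding continuous_map_def
proof (intro conjI allI impI)
  fix U assume "openin Y U"
  then have U: "\<And>x y. y \<in> U \<Longrightarrow> x \<in> topspace Y \<Longrightarrow> point_le Y x y \<Longrightarrow> x \<in> U"
    by (simp add: openin_iff_down_closed[OF Y])
  show "openin X {x \<in> topspace X. f x \<in> U}"
    unfolding openin_iff_down_closed[OF X] using U assms(3,4) by blast
qed fact

lemma continuous_imp_monotone:
  assumes "continuous_map X Y f" "finite_t0_space X" "x \<in> topspace X" "y \<in> topspace X" "point_le X x y"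
  shows "point_le Y (f x) (f y)"
  unfolding point_le_def min_open_def
proof clarify
  fix U assume U: "openin Y U" "f y \<in> U"
  then have "openin X {z \<in> topspace X. f z \<in> U}"
    using assms(1) by (simp add: continuous_map_def)
  then show "f x \<in> U"
    using assms U by (auto simp: openin_iff_down_closed)
qed

lemma point_le_homeomorphic_map:
  assumes "homeomorphic_map X Y f" "finite_t0_space X" "x \<in> topspace X" "y \<in> topspace X"
  shows "point_le Y (f x) (f y) \<longleftrightarrow> point_le X x y"
proof -
  obtain g where g: "homeomorphic_maps X Y f g"
    using assms(1) homeomorphic_map_maps by blast
  then have Y: "finite_t0_space Y"
    using assms(2) homeomorphic_t0_space homeomorphic_space homeomorphic_imp_surjective_map
    by (metis assms(1) finite_imageI finite_t0_space_def)
  have fg: "continuous_map X Y f" "continuous_map Y X g" "g (f x) = x" "g (f y) = y"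
    using g assms(3,4) by (auto simp: homeomorphic_maps_def)
  then have "f x \<in> topspace Y" "f y \<in> topspace Y"
    using assms(3,4) by (auto simp: continuous_map_def)
  then show ?thesis
    using continuous_imp_monotone[OF fg(1) assms(2-4)] continuous_imp_monotone[OF fg(2) Y, of "f x" "f y"]
    by (auto simp: fg)
qed

text \<open>\<open>m\<close> is chosen with the fewest points of \<open>X\<close> strictly above it.
  By transitivity and antisymmetry, a point of \<open>S\<close> strictly above \<open>m\<close>
  would have fewer.\<close>

lemma exists_maximal_point:
  assumes X: "finite_t0_space X" and S: "S \<subseteq> topspace X" "S \<noteq> {}"
  obtains m where "m \<in> S" "\<And>y. y \<in> S \<Longrightarrow> point_le X m y \<Longrightarrow> y = m"
proof -
  have fin: "finite (topspace X)"
    using X finite_t0_spaceD by blast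
  obtain m where m: "m \<in> S" "\<And>y. y \<in> S \<Longrightarrow> card (strict_upper X m) \<le> card (strict_upper X y)"
    using S(2) ex_has_least_nat[of "\<lambda>x. x \<in> S" _ "\<lambda>x. card (strict_upper X x)"] by blast
  have "y = m" if "y \<in> S" "point_le X m y" for y
  proof (rule ccontr)
    assume "y \<noteq> m"
    then have "strict_upper X y \<subset> strict_upper X m"
      using that S m(1) point_le_antisym[OF X, of m y] point_le_trans[of X m y]
      by (auto simp: strict_upper_def)
    moreover have "finite (strict_upper X m)"
      using fin by (simp add: strict_upper_def)
    ultimately show False
      using m(2)[OF that(1)] psubset_card_mono by (metis leD)
  qed
  then show ?thesis
    using that m(1) by blast
qed

lemma exists_minimal_point:
  assumes X: "finite_t0_space X" and S: "S \<subseteq> topspace X" "S \<noteq> {}"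
  obtains m where "m \<in> S" "\<And>y. y \<in> S \<Longrightarrow> point_le X y m \<Longrightarrow> y = m"
proof -
  have fin: "finite (topspace X)"
    using X finite_t0_spaceD by blast
  obtain m where m: "m \<in> S" "\<And>y. y \<in> S \<Longrightarrow> card (strict_lower X m) \<le> card (strict_lower X y)"
    using S(2) ex_has_least_nat[of "\<lambda>x. x \<in> S" _ "\<lambda>x. card (strict_lower X x)"] by blast
  have "y = m" if "y \<in> S" "point_le X y m" for y
  proof (rule ccontr)
    assume "y \<noteq> m"
    then have "strict_lower X y \<subset> strict_lower X m"
      using that S m(1) point_le_antisym[OF X, of m y] point_le_trans[of X _ y m]
      by (auto simp: strict_lower_def)
    moreover have "finite (strict_lower X m)"
      using fin by (simp add: strict_lower_def)
    ultimately show False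
      using m(2)[OF that(1)] psubset_card_mono by (metis leD)
  qed
  then show ?thesis
    using that m(1) by blast
qed

section \<open>Contractible finite spaces\<close>

lemma homotopic_if_pointwise_le:
  assumes X: "finite_t0_space X" and Y: "finite_t0_space Y"
    and f: "continuous_map X Y f" and g: "continuous_map X Y g"
    and le: "\<And>x. x \<in> topspace X \<Longrightarrow> point_le Y (f x) (g x)"
  shows "homotopic_with (\<lambda>_. True) X Y f g"
proof -
  let ?I = "top_of_set {0..1::real}"
  \<comment> \<open>The homotopy jumps at the closed end of the interval, where the larger map sits.\<close>
  define h where "h = (\<lambda>(t::real, x). if t < 1 then f x else g x)"
  have fg: "f x \<in> topspace Y" "g x \<in> topspace Y" if "x \<in> topspace X" for x
    using that f g by (auto simp: continuous_map_def)
  have "continuous_map (prod_topology ?I X) Y h"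
    unfolding continuous_map_def
  proof (intro conjI allI impI)
    show "h \<in> topspace (prod_topology ?I X) \<rightarrow> topspace Y"
      using fg by (auto simp: h_def)
  next
    fix U assume U: "openin Y U"
    \<comment> \<open>Open sets are down-sets and \<open>f x \<le> g x\<close>, so
      \<open>g x \<in> U\<close> implies \<open>f x \<in> U\<close>. The preimage is thus a union of
      two products of open sets.\<close>
    have eq: "{p \<in> topspace (prod_topology ?I X). h p \<in> U} =
        {0..1} \<times> {x \<in> topspace X. g x \<in> U} \<union> {0..<1} \<times> {x \<in> topspace X. f x \<in> U}"
      using U le fg by (fastforce simp: h_def openin_iff_down_closed[OF Y] split: if_splits)
    have "openin ?I {0..<1::real}"
      by (auto simp: openin_open intro!: exI[of _ "{..<1}"])
    moreover have "openin ?I {0..1::real}"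
      by simp
    ultimately show "openin (prod_topology ?I X) {p \<in> topspace (prod_topology ?I X). h p \<in> U}"
      unfolding eq using U f g
      by (intro openin_Un) (auto simp: openin_prod_Times_iff continuous_map_def)
  qed
  then show ?thesis
    unfolding homotopic_with_def by (intro exI[of _ h]) (auto simp: h_def)
qed

text \<open>Pointwise comparable maps are homotopic, so both the identity and the constant map at
  \<open>p\<close> are homotopic to \<open>f\<close>.\<close>

lemma contractible_if_conical:
  assumes X: "finite_t0_space X" and p: "p \<in> topspace X"
    and f: "f \<in> topspace X \<rightarrow> topspace X"
    and mono: "\<And>x y. x \<in> topspace X \<Longrightarrow> y \<in> topspace X \<Longrightarrow> point_le X x y \<Longrightarrow> point_le X (f x) (f y)"
    and le: "\<And>x. x \<in> topspace X \<Longrightarrow> point_le X x (f x) \<and> point_le X p (f x)"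
  shows "contractible_space X"
proof -
  have cf: "continuous_map X X f"
    using monotone_imp_continuous[OF X X f mono] .
  have "homotopic_with (\<lambda>_. True) X X id f"
    by (rule homotopic_if_pointwise_le[OF X X _ cf]) (use le in auto)
  moreover have "homotopic_with (\<lambda>_. True) X X (\<lambda>_. p) f"
    by (rule homotopic_if_pointwise_le[OF X X _ cf]) (use le p in auto)
  ultimately show ?thesis
    unfolding contractible_space_def
    using homotopic_with_trans homotopic_with_symD by blast
qed

section \<open>Dismantling a space by beat points\<close>

definition comparable :: "'a topology \<Rightarrow> 'a \<Rightarrow> 'a \<Rightarrow> bool" where
  "comparable X x y \<longleftrightarrow> point_le X x y \<or> point_le X y x"

text \<open>The point \<open>x\<close> is dominated by \<open>y\<close> in the graph
  \<open>R\<close>: in the clique complex of a reflexive symmetric \<open>R\<close>, adding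
  \<open>y\<close> to a simplex through \<open>x\<close> gives a simplex again. A general relation
  is used so that points beaten from below and from above are treated alike.\<close>

inductive dismantlable :: "('a \<Rightarrow> 'a \<Rightarrow> bool) \<Rightarrow> 'a set \<Rightarrow> bool" for R where
  single: "dismantlable R {x}"
| remove: "x \<in> A \<Longrightarrow> y \<in> A \<Longrightarrow> y \<noteq> x \<Longrightarrow> (\<And>z. z \<in> A \<Longrightarrow> R x z \<Longrightarrow> R y z) \<Longrightarrow>
    dismantlable R (A - {x}) \<Longrightarrow> dismantlable R A"

lemma dismantlable_cong:
  assumes "dismantlable R A" "\<And>x y. x \<in> A \<Longrightarrow> y \<in> A \<Longrightarrow> R x y \<longleftrightarrow> R' x y"
  shows "dismantlable R' A"
  using assms
proof (induction rule: dismantlable.induct)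
  case (remove x A y)
  then show ?case
    by (intro dismantlable.remove[of x A y]) auto
qed (rule dismantlable.single)

text \<open>The points \<open>x\<close> with a largest point below or a smallest point above are the beat points
  of Stong.\<close>

definition beat :: "'a topology \<Rightarrow> 'a \<Rightarrow> 'a \<Rightarrow> bool" where
  "beat X x y \<longleftrightarrow> x \<in> topspace X \<and>
    (y \<in> strict_lower X x \<and> (\<forall>z\<in>strict_lower X x. point_le X z y) \<or>
     y \<in> strict_upper X x \<and> (\<forall>z\<in>strict_upper X x. point_le X y z))"

text \<open>If \<open>f\<close> lies below the identity, let \<open>m\<close> be minimal among the
  points that \<open>f\<close> moves. All points strictly below \<open>m\<close> are fixed, so by
  monotonicity they lie below \<open>f m\<close>, which is itself strictly below \<open>m\<close>.
  Then \<open>m\<close> would be a beat point. The other case is dual, with \<open>m\<close>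
  maximal.\<close>

lemma no_beat_imp_id_rigid:
  assumes X: "finite_t0_space X" and nb: "\<And>x y. \<not> beat X x y"
    and f: "continuous_map X X f"
    and "(\<forall>x\<in>topspace X. point_le X (f x) x) \<or> (\<forall>x\<in>topspace X. point_le X x (f x))"
    and "x \<in> topspace X"
  shows "f x = x"
proof (rule ccontr)
  assume ne: "f x \<noteq> x"
  let ?S = "{x \<in> topspace X. f x \<noteq> x}"
  have S: "?S \<subseteq> topspace X" "?S \<noteq> {}"
    using ne assms by auto
  have fX: "f x \<in> topspace X" if "x \<in> topspace X" for x
    using that f by (auto simp: continuous_map_def)
  show False
    using assms(4)
  proof
    assume le: "\<forall>x\<in>topspace X. point_le X (f x) x"
    obtain m where m: "m \<in> ?S" "\<And>y. y \<in> ?S \<Longrightarrow> point_le X y m \<Longrightarrow> y = m"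
      by (rule exists_minimal_point[OF X S]) blast
    have "point_le X z (f m)" if "z \<in> strict_lower X m" for z
    proof -
      have "f z = z"
        using m that by (auto simp: strict_lower_def)
      then show ?thesis
        using continuous_imp_monotone[OF f X, of z m] that m by (auto simp: strict_lower_def)
    qed
    moreover have "f m \<in> strict_lower X m"
      using m fX le by (auto simp: strict_lower_def)
    ultimately show False
      using nb[of m "f m"] m by (auto simp: beat_def)
  next
    assume le: "\<forall>x\<in>topspace X. point_le X x (f x)"
    obtain m where m: "m \<in> ?S" "\<And>y. y \<in> ?S \<Longrightarrow> point_le X m y \<Longrightarrow> y = m"
      by (rule exists_maximal_point[OF X S]) blast
    have "point_le X (f m) z" if "z \<in> strict_upper X m" for z
    proof -
      have "f z = z"
        using m that by (auto simp: strict_upper_def)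
      then show ?thesis
        using continuous_imp_monotone[OF f X, of m z] that m by (auto simp: strict_upper_def)
    qed
    moreover have "f m \<in> strict_upper X m"
      using m fX le by (auto simp: strict_upper_def)
    ultimately show False
      using nb[of m "f m"] m by (auto simp: beat_def)
  qed
qed

text \<open>Stong's theorem. Along a homotopy from the identity, nearby maps are comparable with the
  map at the given time, so by rigidity the times at which the map is the identity form a clopen
  subset of the interval.\<close>

lemma contractible_no_beat_imp_singleton:
  assumes X: "finite_t0_space X" and nb: "\<And>x y. \<not> beat X x y"
    and c: "contractible_space X" and ne: "topspace X \<noteq> {}"
  obtains a where "topspace X = {a}"
proof -
  let ?I = "top_of_set {0..1::real}"
  obtain a h where h: "continuous_map (prod_topology ?I X) X h"
    and h0: "\<And>x. h (0, x) = x" and h1: "\<And>x. h (1, x) = a"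
    using c unfolding contractible_space_def homotopic_with_def by auto
  have hx: "continuous_map X X (\<lambda>x. h (t, x))" if "t \<in> {0..1}" for t
    by (rule continuous_map_compose[OF _ h, unfolded o_def])
      (use that in \<open>auto intro!: continuous_map_pairedI\<close>)
  have ht: "continuous_map ?I X (\<lambda>t. h (t, x))" if "x \<in> topspace X" for x
    by (rule continuous_map_compose[OF _ h, unfolded o_def])
      (use that in \<open>auto intro!: continuous_map_pairedI\<close>)
  have hX: "h (t, x) \<in> topspace X" if "t \<in> {0..1}" "x \<in> topspace X" for t x
    using hx[OF that(1)] that(2) by (auto simp: continuous_map_def)
  \<comment> \<open>The times whose map lies pointwise below the map at time \<open>t\<close>. This
    is a finite intersection of preimages of minimal open sets, hence an open neighbourhood of
    \<open>t\<close>.\<close>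
  define V where "V t = {s \<in> {0..1}. \<forall>x\<in>topspace X. point_le X (h (s, x)) (h (t, x))}" for t
  have V: "openin ?I (V t)" if t: "t \<in> {0..1}" for t
  proof -
    have "openin ?I {s \<in> topspace ?I. h (s, x) \<in> min_open X (h (t, x))}" if x: "x \<in> topspace X" for x
      using ht[OF x] openin_min_open[OF X hX[OF t x]] by (simp add: continuous_map_def)
    then have "openin ?I (\<Inter>x\<in>topspace X. {s \<in> topspace ?I. h (s, x) \<in> min_open X (h (t, x))})"
      using ne X finite_t0_spaceD(1) by (intro openin_Inter) auto
    \<comment> \<open>A point of \<open>X\<close> keeps the intersection inside the interval; over
      an empty index set it would be \<open>UNIV\<close>.\<close>
    moreover obtain b where "b \<in> topspace X"
      using ne by blast
    then have "(\<Inter>x\<in>topspace X. {s \<in> topspace ?I. h (s, x) \<in> min_open X (h (t, x))}) = V t"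
      by (auto simp: V_def point_le_def)
    ultimately show ?thesis
      by simp
  qed
  have tV: "t \<in> V t" if "t \<in> {0..1}" for t
    using that by (simp add: V_def point_le_refl)
  define T where "T = {t \<in> {0..1}. \<forall>x\<in>topspace X. h (t, x) = x}"
  have down: "s \<in> T" if "t \<in> T" "s \<in> V t" for s t
  proof -
    have s: "s \<in> {0..1}"
      using that(2) by (simp add: V_def)
    have "\<forall>x\<in>topspace X. point_le X (h (s, x)) x"
      using that by (simp add: T_def V_def)
    then have "h (s, x) = x" if "x \<in> topspace X" for x
      using no_beat_imp_id_rigid[OF X nb hx[OF s] _ that] by blast
    then show ?thesis
      using s by (simp add: T_def)
  qed
  \<comment> \<open>This is the other half of rigidity: now the map at time \<open>t\<close> lies
    above the identity. It shows that \<open>V t\<close> is disjoint from \<open>T\<close> when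
    \<open>t\<close> is outside \<open>T\<close>, so the complement of \<open>T\<close> is
    open.\<close>
  have up: "t \<in> T" if "s \<in> T" "t \<in> {0..1}" "s \<in> V t" for s t
  proof -
    have "\<forall>x\<in>topspace X. point_le X x (h (t, x))"
      using that by (simp add: T_def V_def)
    then have "h (t, x) = x" if "x \<in> topspace X" for x
      using no_beat_imp_id_rigid[OF X nb hx[OF \<open>t \<in> {0..1}\<close>] _ that] by blast
    then show ?thesis
      using that by (simp add: T_def)
  qed
  have "openin ?I T"
  proof (subst openin_subopen, intro ballI exI conjI)
    fix t assume t: "t \<in> T"
    then have "t \<in> {0..1}"
      by (simp add: T_def)
    then show "openin ?I (V t)" "t \<in> V t"
      using V tV by auto
    show "V t \<subseteq> T"
      using down[OF t] by blast
  qed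
  moreover have "openin ?I ({0..1} - T)"
  proof (subst openin_subopen, intro ballI exI conjI)
    fix t assume t: "t \<in> {0..1} - T"
    then show "openin ?I (V t)" "t \<in> V t"
      using V tV by auto
    show "V t \<subseteq> {0..1} - T"
      using up[of _ t] t by (auto simp: V_def)
  qed
  then have "closedin ?I T"
    by (auto simp: closedin_def T_def)
  moreover have "connected {0..1::real}"
    by simp
  ultimately have "T = {} \<or> T = {0..1}"
    unfolding connected_clopen by blast
  moreover have "0 \<in> T"
    by (simp add: T_def h0)
  ultimately have "1 \<in> T"
    by auto
  then have "\<forall>x\<in>topspace X. x = a"
    by (simp add: T_def h1)
  then have "topspace X = {a}"
    using ne by fast
  then show ?thesis
    by (rule that)
qed

text \<open>Moving \<open>x\<close> to \<open>y\<close> and fixing all other points is monotone,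
  because \<open>y\<close> is the largest point below \<open>x\<close> or the smallest one above it.
  This map is a retraction, and retracts of contractible spaces are contractible.\<close>

lemma contractible_space_remove_beat:
  assumes X: "finite_t0_space X" and c: "contractible_space X" and b: "beat X x y"
  shows "contractible_space (subtopology X (topspace X - {x}))"
proof -
  let ?Y = "subtopology X (topspace X - {x})"
  let ?r = "\<lambda>z. if z = x then y else z"
  have xy: "x \<in> topspace X" "y \<in> topspace X" "y \<noteq> x"
    using b by (auto simp: beat_def strict_lower_def strict_upper_def)
  have "continuous_map X X ?r"
    using b by (intro monotone_imp_continuous[OF X X])
      (auto simp: beat_def strict_lower_def strict_upper_def intro: point_le_refl point_le_trans)
  then have "continuous_map X ?Y ?r"
    using xy by (auto simp: continuous_map_in_subtopology)
  then have "retraction_map X ?Y ?r"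
    using xy unfolding retraction_map_def retraction_maps_def
    by (intro exI[of _ id]) (auto simp: continuous_map_from_subtopology)
  then show ?thesis
    using c contractible_space_retraction_map_image by blast
qed

text \<open>Beat points are removed as long as there are any. The space stays contractible, and once
  no beat point is left it is a single point.\<close>

lemma contractible_imp_dismantlable:
  assumes "finite_t0_space X" "contractible_space X" "topspace X \<noteq> {}"
  shows "dismantlable (comparable X) (topspace X)"
  using assms
proof (induction "card (topspace X)" arbitrary: X rule: less_induct)
  case less
  show ?case
  proof (cases "\<exists>x y. beat X x y")
    case False
    then obtain a where "topspace X = {a}"
      using contractible_no_beat_imp_singleton[OF less.prems(1)] less.prems by blast
    then show ?thesis
      by (simp add: dismantlable.single)
  next
    case True
    then obtain x y where b: "beat X x y"
      by blast
    let ?Y = "subtopology X (topspace X - {x})"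
    have xy: "x \<in> topspace X" "y \<in> topspace X" "y \<noteq> x"
      using b by (auto simp: beat_def strict_lower_def strict_upper_def)
    have top: "topspace ?Y = topspace X - {x}"
      by auto
    have "card (topspace ?Y) < card (topspace X)"
      unfolding top using xy less.prems(1) finite_t0_spaceD(1) by (intro card_Diff1_less) auto
    then have "dismantlable (comparable ?Y) (topspace X - {x})"
      using less.hyps[of ?Y] less.prems(1) xy top finite_t0_space_subtopology
        contractible_space_remove_beat[OF less.prems(1,2) b] by (metis Diff_iff empty_iff singletonD)
    then have "dismantlable (comparable X) (topspace X - {x})"
      by (rule dismantlable_cong) (use less.prems in \<open>auto simp: comparable_def point_le_subtopology\<close>)
    \<comment> \<open>Suppose \<open>y\<close> is the largest point below \<open>x\<close>. A point
      below \<open>x\<close> is then below \<open>y\<close> or equal to \<open>x\<close>, and a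
      point above \<open>x\<close> is above \<open>y\<close>. The other kind of beat point is
      dual.\<close>
    moreover have "comparable X y z" if "z \<in> topspace X" "comparable X x z" for z
      using b that point_le_refl[of X y] point_le_trans[of X]
      unfolding beat_def comparable_def strict_lower_def strict_upper_def by blast
    ultimately show ?thesis
      using xy dismantlable.remove[of x _ y] by blast
  qed
qed

section \<open>Simplicial collapses\<close>

lemma finite_complexD:
  assumes "finite_complex K"
  shows "finite K" "S \<in> K \<Longrightarrow> finite S" "S \<in> K \<Longrightarrow> S \<noteq> {}" "{} \<notin> K"
    "S \<in> K \<Longrightarrow> T \<subseteq> S \<Longrightarrow> T \<noteq> {} \<Longrightarrow> T \<in> K"
  using assms unfolding finite_complex_def by blast+

lemma finite_complex_subcomplex:
  assumes "finite_complex K" "L \<subseteq> K"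
    and "\<And>S T. S \<in> L \<Longrightarrow> T \<in> K \<Longrightarrow> T \<subseteq> S \<Longrightarrow> T \<in> L"
  shows "finite_complex L"
  unfolding finite_complex_def
proof (intro conjI ballI allI impI)
  show "finite L"
    using finite_complexD(1)[OF assms(1)] assms(2) finite_subset by blast
next
  fix S assume "S \<in> L"
  then show "finite S" "S \<noteq> {}"
    using finite_complexD(2,3)[OF assms(1)] assms(2) by auto
next
  fix S T assume T: "S \<in> L" "T \<subseteq> S \<and> T \<noteq> {}"
  then have "T \<in> K"
    using finite_complexD(5)[OF assms(1)] assms(2) by blast
  then show "T \<in> L"
    using assms(3) T by blast
qed

text \<open>The cone over the boundary of \<open>S\<close> contains every face of
  \<open>insert a S\<close> except \<open>S\<close> and \<open>insert a S\<close>. So exactly these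
  two are missing from \<open>L\<close>, and since \<open>L\<close> is closed under faces, no
  simplex of \<open>L\<close> contains \<open>S\<close>. An elementary collapse is therefore the
  removal of a free face together with its only proper coface, which is the form used from here
  on.\<close>

lemma elementary_simplicial_collapse_iff:
  "elementary_simplicial_collapse K L \<longleftrightarrow> finite_complex K \<and>
    (\<exists>S a. S \<in> K \<and> a \<notin> S \<and> insert a S \<in> K \<and> L = K - {S, insert a S} \<and>
      (\<forall>T\<in>K. S \<subseteq> T \<longrightarrow> T = S \<or> T = insert a S))" (is "?l \<longleftrightarrow> ?r")
proof
  assume ?l
  then obtain S a where K: "finite_complex K" and L: "finite_complex L"
    and S: "S \<in> K" "a \<in> \<Union>K" "a \<notin> S" and KL: "K = L \<union> simplex_faces (insert a S)"
    and int: "L \<inter> simplex_faces (insert a S) = cone a (simplex_boundary S)"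
    unfolding elementary_simplicial_collapse_def by blast
  have ne: "S \<noteq> {}"
    using finite_complexD(3)[OF K S(1)] .
  have aS: "insert a S \<in> simplex_faces (insert a S)" "S \<in> simplex_faces (insert a S)"
    using ne by (auto simp: simplex_faces_def)
  have "S \<notin> cone a (simplex_boundary S)"
    using S(3) by (auto simp: cone_def simplex_boundary_def)
  then have "S \<notin> L"
    using int aS by blast
  then have SL: "T \<notin> L" if "S \<subseteq> T" for T
    using finite_complexD(5)[OF L _ that ne] by blast
  have "T = S \<or> T = insert a S" if "T \<in> K" "S \<subseteq> T" for T
    using SL[OF that(2)] that KL by (auto simp: simplex_faces_def)
  moreover have "K - {S, insert a S} \<subseteq> L"
  proof
    fix T assume T: "T \<in> K - {S, insert a S}"
    show "T \<in> L"
    proof (rule ccontr)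
      assume "T \<notin> L"
      then have T': "T \<subseteq> insert a S" "T \<noteq> {}" "T \<noteq> S" "T \<noteq> insert a S"
        using T KL by (auto simp: simplex_faces_def)
      have "T \<in> cone a (simplex_boundary S)"
      proof (cases "a \<in> T")
        case True
        then have "T = insert a (T - {a})" "T - {a} \<subseteq> S" "T - {a} \<noteq> S"
          using T' by auto
        then show ?thesis
          unfolding cone_def simplex_boundary_def simplex_faces_def by blast
      qed (use T' in \<open>auto simp: cone_def simplex_boundary_def simplex_faces_def\<close>)
      then show False
        using int \<open>T \<notin> L\<close> by blast
    qed
  qed
  then have "L = K - {S, insert a S}"
    using KL SL[of S] SL[of "insert a S"] by blast
  ultimately show ?r
    using K S KL aS by blast
next
  assume ?r
  then obtain S a where K: "finite_complex K" and S: "S \<in> K" "a \<notin> S" "insert a S \<in> K"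
    and L: "L = K - {S, insert a S}"
    and free: "\<And>T. T \<in> K \<Longrightarrow> S \<subseteq> T \<Longrightarrow> T = S \<or> T = insert a S"
    by blast
  have ne: "S \<noteq> {}"
    using finite_complexD(3)[OF K S(1)] .
  have faces: "simplex_faces (insert a S) \<subseteq> K"
    using finite_complexD(5)[OF K S(3)] by (auto simp: simplex_faces_def)
  have "finite_complex L"
  proof (rule finite_complex_subcomplex[OF K])
    fix T T' assume T: "T \<in> L" "T' \<in> K" "T' \<subseteq> T"
    then have "\<not> S \<subseteq> T'"
      using free[of T] L by blast
    then show "T' \<in> L"
      using T(2) L by blast
  qed (use L in blast)
  moreover have "K = L \<union> simplex_faces (insert a S)"
    using L faces ne by (auto simp: simplex_faces_def)
  moreover have "L \<inter> simplex_faces (insert a S) = cone a (simplex_boundary S)"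
  proof (intro equalityI subsetI)
    fix T assume "T \<in> L \<inter> simplex_faces (insert a S)"
    then have T: "T \<subseteq> insert a S" "T \<noteq> {}" "T \<noteq> S" "T \<noteq> insert a S"
      using L by (auto simp: simplex_faces_def)
    show "T \<in> cone a (simplex_boundary S)"
    proof (cases "a \<in> T")
      case True
      then have "T = insert a (T - {a})" "T - {a} \<subseteq> S" "T - {a} \<noteq> S"
        using T by auto
      then show ?thesis
        unfolding cone_def simplex_boundary_def simplex_faces_def by blast
    qed (use T in \<open>auto simp: cone_def simplex_boundary_def simplex_faces_def\<close>)
  next
    fix T assume "T \<in> cone a (simplex_boundary S)"
    then have "T \<in> simplex_faces (insert a S)" "T \<noteq> S" "T \<noteq> insert a S"
      using S(2) ne by (auto simp: cone_def simplex_boundary_def simplex_faces_def)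
    then show "T \<in> L \<inter> simplex_faces (insert a S)"
      using faces L by blast
  qed
  ultimately show ?l
    unfolding elementary_simplicial_collapse_def using K S by blast
qed

lemma elementary_simplicial_collapse_finite_complex:
  "elementary_simplicial_collapse K L \<Longrightarrow> finite_complex K \<and> finite_complex L"
  by (simp add: elementary_simplicial_collapse_def)

lemma simplicial_collapse_trans:
  "simplicial_collapse K L \<Longrightarrow> simplicial_collapse L M \<Longrightarrow> simplicial_collapse K M"
  unfolding simplicial_collapse_def by (rule rtranclp_trans)

lemma simplicial_collapse_subset:
  assumes "simplicial_collapse K L"
  shows "L \<subseteq> K"
  using assms unfolding simplicial_collapse_def
  by induction (auto simp: elementary_simplicial_collapse_iff)

lemma simplicial_collapse_finite_complex:
  assumes "simplicial_collapse K L" "finite_complex K"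
  shows "finite_complex L"
  using assms unfolding simplicial_collapse_def
  by induction (auto simp: elementary_simplicial_collapse_def)

text \<open>The hypothesis says that the link of \<open>S\<close> is a cone with apex \<open>a\<close>. The simplices
  containing \<open>S\<close> are removed in pairs \<open>T, T \<union> {a}\<close>, the largest ones first.\<close>

lemma simplicial_collapse_open_star:
  assumes "finite_complex K" "S \<noteq> {}" "a \<notin> S"
    and "\<And>T. T \<in> K \<Longrightarrow> S \<subseteq> T \<Longrightarrow> insert a T \<in> K"
  shows "simplicial_collapse K {T \<in> K. \<not> S \<subseteq> T}"
  using assms(1,4)
proof (induction "card K" arbitrary: K rule: less_induct)
  case less
  define Q where "Q = {T \<in> K. S \<subseteq> T \<and> a \<notin> T}"
  show ?case
  proof (cases "Q = {}")
    case True
    have "\<not> S \<subseteq> T" if "T \<in> K" for T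
    proof
      assume "S \<subseteq> T"
      then have "S \<in> K"
        using finite_complexD(5)[OF less.prems(1) that _ assms(2)] by blast
      then show False
        using True assms(3) by (auto simp: Q_def)
    qed
    then have "{T \<in> K. \<not> S \<subseteq> T} = K"
      by blast
    then show ?thesis
      by (simp add: simplicial_collapse_def)
  next
    case False
    have "finite Q"
      using finite_complexD(1)[OF less.prems(1)] by (simp add: Q_def)
    then obtain T where T: "T \<in> Q" and max: "\<And>T'. T' \<in> Q \<Longrightarrow> T \<subseteq> T' \<Longrightarrow> T' = T"
      using finite_has_maximal[OF _ False] by blast
    let ?L = "K - {T, insert a T}"
    have TK: "T \<in> K" "S \<subseteq> T" "a \<notin> T" "insert a T \<in> K"
      using T less.prems(2)[of T] by (auto simp: Q_def)
    have free: "T' = T \<or> T' = insert a T" if T': "T' \<in> K" "T \<subseteq> T'" for T'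
    proof (cases "a \<in> T'")
      case True
      have sub: "T \<subseteq> T' - {a}" "T' - {a} \<noteq> {}"
        using T' TK assms(2) by auto
      then have "T' - {a} \<in> Q"
        using finite_complexD(5)[OF less.prems(1) T'(1)] TK by (auto simp: Q_def)
      then have "T' - {a} = T"
        using max sub(1) by blast
      then show ?thesis
        using True by blast
    next
      case False
      then have "T' \<in> Q"
        using T' TK by (auto simp: Q_def)
      then show ?thesis
        using max T'(2) by blast
    qed
    then have step: "elementary_simplicial_collapse K ?L"
      using less.prems(1) TK unfolding elementary_simplicial_collapse_iff by blast
    have "card ?L < card K"
      using finite_complexD(1)[OF less.prems(1)] TK(1) by (intro psubset_card_mono) auto
    moreover have "finite_complex ?L"
      using step elementary_simplicial_collapse_finite_complex by blast
    moreover have "insert a T' \<in> ?L" if "T' \<in> ?L" "S \<subseteq> T'" for T'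
    proof (cases "a \<in> T'")
      case True
      then show ?thesis
        using that by (simp add: insert_absorb)
    next
      case False
      then have "insert a T' \<noteq> insert a T"
        using that TK(3) by (auto simp: insert_ident)
      then show ?thesis
        using less.prems(2)[of T'] that TK(3) by blast
    qed
    ultimately have "simplicial_collapse ?L {T' \<in> ?L. \<not> S \<subseteq> T'}"
      by (rule less.hyps)
    moreover have "{T' \<in> ?L. \<not> S \<subseteq> T'} = {T' \<in> K. \<not> S \<subseteq> T'}"
      using TK by blast
    ultimately show ?thesis
      using step unfolding simplicial_collapse_def by (simp add: converse_rtranclp_into_rtranclp)
  qed
qed

section \<open>Simple homotopy types\<close>

lemma complex_iso_iff: "complex_iso K L \<longleftrightarrow> (\<exists>f. inj_on f (\<Union>K) \<and> L = (`) f ` K)"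
proof -
  have "bij_betw f (\<Union>K) (\<Union>((`) f ` K)) \<longleftrightarrow> inj_on f (\<Union>K)" for f :: "'a \<Rightarrow> 'b"
    unfolding bij_betw_def by blast
  then show ?thesis
    unfolding complex_iso_def by metis
qed

lemma complex_iso_image: "inj_on f (\<Union>K) \<Longrightarrow> complex_iso K ((`) f ` K)"
  by (auto simp: complex_iso_iff)

lemma complex_iso_refl: "complex_iso K K"
  unfolding complex_iso_iff by (intro exI[of _ "\<lambda>x. x"]) auto

lemma complex_iso_trans:
  assumes "complex_iso K L" "complex_iso L M"
  shows "complex_iso K M"
proof -
  obtain f g where f: "inj_on f (\<Union>K)" "L = (`) f ` K" and g: "inj_on g (\<Union>L)" "M = (`) g ` L"
    using assms unfolding complex_iso_iff by blast
  have "\<Union>L = f ` \<Union>K"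
    unfolding f(2) by blast
  then have "inj_on (g \<circ> f) (\<Union>K)"
    using f(1) g(1) by (intro comp_inj_on) auto
  moreover have "M = (`) (g \<circ> f) ` K"
    by (simp add: f(2) g(2) image_image image_comp)
  ultimately show ?thesis
    unfolding complex_iso_iff by blast
qed

lemma complex_iso_sym:
  assumes "complex_iso K L"
  shows "complex_iso L K"
proof -
  obtain f where f: "inj_on f (\<Union>K)" "L = (`) f ` K"
    using assms by (auto simp: complex_iso_iff)
  let ?g = "the_inv_into (\<Union>K) f"
  have "\<Union>L = f ` \<Union>K"
    using f by blast
  then have "inj_on ?g (\<Union>L)"
    using inj_on_the_inv_into[OF f(1)] by simp
  moreover have "?g ` f ` S = S" if "S \<in> K" for S
  proof -
    have "?g (f x) = x" if "x \<in> S" for x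
      using the_inv_into_f_f[OF f(1)] that \<open>S \<in> K\<close> by blast
    then show ?thesis
      by (simp add: image_image)
  qed
  then have "K = (`) ?g ` L"
    by (simp add: f(2) image_image)
  ultimately show ?thesis
    unfolding complex_iso_iff by blast
qed

section \<open>Collapses under injective vertex maps\<close>

lemma finite_complex_image:
  assumes "finite_complex K"
  shows "finite_complex ((`) f ` K)"
  unfolding finite_complex_def
proof (intro conjI ballI allI impI)
  fix S T assume S: "S \<in> (`) f ` K" and T: "T \<subseteq> S \<and> T \<noteq> {}"
  then obtain R where R: "R \<in> K" "S = f ` R"
    by blast
  then have "T = f ` {x \<in> R. f x \<in> T}" "{x \<in> R. f x \<in> T} \<noteq> {}"
    using T by auto
  then show "T \<in> (`) f ` K"
    using finite_complexD(5)[OF assms R(1), of "{x \<in> R. f x \<in> T}"] by blast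
qed (use finite_complexD[OF assms] in auto)

lemma elementary_simplicial_collapse_image:
  assumes f: "inj_on f (\<Union>K)" and "elementary_simplicial_collapse K L"
  shows "elementary_simplicial_collapse ((`) f ` K) ((`) f ` L)"
proof -
  obtain S a where K: "finite_complex K" and S: "S \<in> K" "a \<notin> S" "insert a S \<in> K"
    and L: "L = K - {S, insert a S}"
    and free: "\<And>T. T \<in> K \<Longrightarrow> S \<subseteq> T \<Longrightarrow> T = S \<or> T = insert a S"
    using assms(2) unfolding elementary_simplicial_collapse_iff by blast
  have inj: "inj_on ((`) f) K"
    using inj_on_image_Pow[OF f] by (rule inj_on_subset) blast
  have "(`) f ` L = (`) f ` K - (`) f ` {S, insert a S}"
    unfolding L using S by (intro inj_on_image_set_diff[OF inj]) auto
  then have fL: "(`) f ` L = (`) f ` K - {f ` S, insert (f a) (f ` S)}"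
    by simp
  have fa: "f a \<notin> f ` S"
    using S by (subst inj_on_image_mem_iff[OF f]) auto
  have faS: "insert (f a) (f ` S) \<in> (`) f ` K"
    using S(3) by (metis image_eqI image_insert)
  have "f ` T = f ` S \<or> f ` T = insert (f a) (f ` S)" if "T \<in> K" "f ` S \<subseteq> f ` T" for T
  proof -
    have "S \<subseteq> T"
      using that S by (subst (asm) inj_on_image_subset_iff[OF f]) auto
    then show ?thesis
      using free[OF that(1)] by auto
  qed
  then have "\<forall>T\<in>(`) f ` K. f ` S \<subseteq> T \<longrightarrow> T = f ` S \<or> T = insert (f a) (f ` S)"
    by simp
  then show ?thesis
    unfolding elementary_simplicial_collapse_iff
    using finite_complex_image[OF K] imageI[OF S(1), of "(`) f"] fL fa faS by metis
qed

lemma simplicial_collapse_image: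
  assumes "simplicial_collapse K L" "inj_on f (\<Union>K)"
  shows "simplicial_collapse ((`) f ` K) ((`) f ` L)"
  using assms unfolding simplicial_collapse_def
proof (induction rule: converse_rtranclp_induct)
  case (step K M)
  then have "elementary_simplicial_collapse ((`) f ` K) ((`) f ` M)"
    by (intro elementary_simplicial_collapse_image)
  moreover have "inj_on f (\<Union>M)"
    using step by (intro inj_on_subset[OF step.prems]) (auto simp: elementary_simplicial_collapse_iff)
  ultimately show ?case
    using step.IH by (meson converse_rtranclp_into_rtranclp)
qed simp

lemma complex_step_image:
  assumes "complex_step K L" "inj_on f (\<Union>K \<union> \<Union>L)"
  shows "complex_step ((`) f ` K) ((`) f ` L)"
proof -
  have "inj_on f (\<Union>K)" "inj_on f (\<Union>L)"
    using assms(2) by (auto intro: inj_on_subset)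
  then show ?thesis
    using assms(1) simplicial_collapse_image[of K L f] simplicial_collapse_image[of L K f]
      finite_complex_image[of K f] finite_complex_image[of L f]
    unfolding complex_step_def by blast
qed

lemma finite_complex_vertices: "finite_complex K \<Longrightarrow> finite (\<Union>K)"
  by (auto simp: finite_complex_def)

text \<open>New arguments are shifted past a bound for the values of \<open>h\<close> on
  \<open>A\<close>. This is the room that representatives on the natural numbers provide: a
  relabelling of one object extends to a neighbour in the sequence with further vertices or
  points.\<close>

lemma inj_on_extend:
  fixes h :: "nat \<Rightarrow> nat"
  assumes "finite A" "inj_on h A"
  obtains g where "inj_on g (A \<union> B)" "\<And>x. x \<in> A \<Longrightarrow> g x = h x"
proof -
  obtain n where n: "\<And>x. x \<in> A \<Longrightarrow> h x < n"
    using finite_nat_set_iff_bounded[of "h ` A"] assms(1) by auto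
  show ?thesis
  proof
    have "h x \<noteq> n + y" if "x \<in> A" for x y
      using n[OF that] by simp
    then show "inj_on (\<lambda>x. if x \<in> A then h x else n + x) (A \<union> B)"
      using inj_onD[OF assms(2)] by (intro inj_onI) (metis add_left_cancel)
  qed simp
qed

text \<open>Two sequences meeting in isomorphic complexes can be joined once the second is moved
  along the isomorphism. A step may be an expansion with vertices outside \<open>\<Union>K\<close>,
  so the vertex map is extended anew before each step.\<close>

lemma complex_steps_transfer:
  fixes K L K' :: "nat set set"
  assumes "complex_step\<^sup>*\<^sup>* K L" "complex_iso K K'"
  shows "\<exists>L'. complex_step\<^sup>*\<^sup>* K' L' \<and> complex_iso L L'"
  using assms
proof (induction arbitrary: K' rule: converse_rtranclp_induct)
  case (step K M)
  obtain h where h: "inj_on h (\<Union>K)" "K' = (`) h ` K"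
    using step.prems by (auto simp: complex_iso_iff)
  have "finite (\<Union>K)"
    using step.hyps(1) finite_complex_vertices by (auto simp: complex_step_def)
  then obtain g where g: "inj_on g (\<Union>K \<union> \<Union>M)" "\<And>x. x \<in> \<Union>K \<Longrightarrow> g x = h x"
    using inj_on_extend[OF _ h(1)] by blast
  have "K' = (`) g ` K"
    unfolding h(2) using g(2) by (intro image_cong refl) (metis UnionI)
  then have "complex_step K' ((`) g ` M)"
    using complex_step_image[OF step.hyps(1) g(1)] by simp
  moreover have "complex_iso M ((`) g ` M)"
    using g(1) by (auto simp: complex_iso_iff inj_on_Un)
  ultimately show ?case
    using step.IH by (meson converse_rtranclp_into_rtranclp)
qed blast

section \<open>Simple homotopy type as an equivalence relation\<close>

lemma same_simple_homotopy_type_sym: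
  assumes "same_simple_homotopy_type K L"
  shows "same_simple_homotopy_type L K"
proof -
  have "complex_step\<inverse>\<inverse> = complex_step"
    by (auto simp: complex_step_def fun_eq_iff)
  then have "complex_step\<^sup>*\<^sup>* L' K'" if "complex_step\<^sup>*\<^sup>* K' L'" for K' L' :: "nat set set"
    using that by (metis conversepI rtranclp_conversep)
  then show ?thesis
    using assms complex_iso_sym unfolding same_simple_homotopy_type_def by meson
qed

lemma same_simple_homotopy_type_trans:
  assumes "same_simple_homotopy_type K L" "same_simple_homotopy_type L M"
  shows "same_simple_homotopy_type K M"
proof -
  obtain K' L' :: "nat set set" where 1: "complex_iso K K'" "complex_step\<^sup>*\<^sup>* K' L'" "complex_iso L' L"
    using assms(1) by (auto simp: same_simple_homotopy_type_def)
  obtain L'' M' :: "nat set set" where 2: "complex_iso L L''" "complex_step\<^sup>*\<^sup>* L'' M'" "complex_iso M' M"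
    using assms(2) by (auto simp: same_simple_homotopy_type_def)
  have "complex_iso L'' L'"
    using 1(3) 2(1) complex_iso_sym complex_iso_trans by blast
  then obtain M'' where "complex_step\<^sup>*\<^sup>* L' M''" "complex_iso M' M''"
    using complex_steps_transfer[OF 2(2)] by blast
  then show ?thesis
    using 1 2 assms complex_iso_sym complex_iso_trans unfolding same_simple_homotopy_type_def
    by (meson rtranclp_trans)
qed

lemma exists_nat_complex:
  assumes "finite_complex K"
  obtains K' :: "nat set set" where "complex_iso K K'" "finite_complex K'"
proof -
  obtain f :: "'a \<Rightarrow> nat" where "inj_on f (\<Union>K)"
    using finite_imp_inj_to_nat_seg[OF finite_complex_vertices[OF assms]] by blast
  then show ?thesis
    using that[of "(`) f ` K"] finite_complex_image[OF assms] by (auto simp: complex_iso_iff)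
qed

lemma complex_iso_imp_same_simple_homotopy_type:
  assumes "complex_iso K L" "finite_complex K"
  shows "same_simple_homotopy_type K L"
proof -
  obtain K' :: "nat set set" where K': "complex_iso K K'"
    using exists_nat_complex[OF assms(2)] by blast
  moreover have "finite_complex L"
    using assms finite_complex_image by (auto simp: complex_iso_iff)
  ultimately show ?thesis
    using assms complex_iso_sym complex_iso_trans unfolding same_simple_homotopy_type_def by blast
qed

text \<open>One injection of the vertices of \<open>K\<close> into the natural numbers represents
  \<open>K\<close> and its subcomplex \<open>L\<close> at once, so a single step joins the two
  representatives.\<close>

lemma simplicial_collapse_imp_same_simple_homotopy_type:
  assumes "simplicial_collapse K L" "finite_complex K"
  shows "same_simple_homotopy_type K L"
proof -
  have L: "finite_complex L" "\<Union>L \<subseteq> \<Union>K"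
    using simplicial_collapse_finite_complex[OF assms] simplicial_collapse_subset[OF assms(1)] by auto
  obtain f :: "'a \<Rightarrow> nat" where f: "inj_on f (\<Union>K)"
    using finite_imp_inj_to_nat_seg[OF finite_complex_vertices[OF assms(2)]] by blast
  have "complex_step ((`) f ` K) ((`) f ` L)"
    using simplicial_collapse_image[OF assms(1) f] finite_complex_image assms L
    by (auto simp: complex_step_def)
  moreover have "complex_iso K ((`) f ` K)" "complex_iso L ((`) f ` L)"
    using f inj_on_subset[OF f L(2)] by (auto simp: complex_iso_iff)
  ultimately show ?thesis
    using assms(2) L(1) complex_iso_sym unfolding same_simple_homotopy_type_def by blast
qed

section \<open>Simple equivalence of spaces\<close>

text \<open>The quotient topology along \<open>f\<close>. For injective \<open>f\<close> it is a
  homeomorphic copy of \<open>X\<close>, and every homeomorphic copy arises in this way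
  (\<open>homeomorphic_space_iff_relabel\<close>). It does for spaces what the image under an
  injective vertex map does for complexes: one \<open>f\<close> can act on several spaces at the
  same time.\<close>

definition relabel :: "('a \<Rightarrow> 'b) \<Rightarrow> 'a topology \<Rightarrow> 'b topology" where
  "relabel f X = topology (\<lambda>U. U \<subseteq> f ` topspace X \<and> openin X {x \<in> topspace X. f x \<in> U})"

lemma openin_relabel:
  "openin (relabel f X) U \<longleftrightarrow> U \<subseteq> f ` topspace X \<and> openin X {x \<in> topspace X. f x \<in> U}"
proof -
  have "istopology (\<lambda>U. U \<subseteq> f ` topspace X \<and> openin X {x \<in> topspace X. f x \<in> U})"
    unfolding istopology_def
  proof (intro conjI allI impI)
    fix S T assume "S \<subseteq> f ` topspace X \<and> openin X {x \<in> topspace X. f x \<in> S}"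
      "T \<subseteq> f ` topspace X \<and> openin X {x \<in> topspace X. f x \<in> T}"
    moreover have "{x \<in> topspace X. f x \<in> S \<inter> T} =
        {x \<in> topspace X. f x \<in> S} \<inter> {x \<in> topspace X. f x \<in> T}"
      by blast
    ultimately show "S \<inter> T \<subseteq> f ` topspace X" "openin X {x \<in> topspace X. f x \<in> S \<inter> T}"
      by auto
  next
    fix \<U> assume U: "\<forall>U\<in>\<U>. U \<subseteq> f ` topspace X \<and> openin X {x \<in> topspace X. f x \<in> U}"
    then show "\<Union>\<U> \<subseteq> f ` topspace X"
      by blast
    have "{x \<in> topspace X. f x \<in> \<Union>\<U>} = (\<Union>U\<in>\<U>. {x \<in> topspace X. f x \<in> U})"
      by blast
    then show "openin X {x \<in> topspace X. f x \<in> \<Union>\<U>}"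
      using U by auto
  qed
  then show ?thesis
    by (simp add: relabel_def)
qed

lemma topspace_relabel: "topspace (relabel f X) = f ` topspace X"
proof -
  have "{x \<in> topspace X. f x \<in> f ` topspace X} = topspace X"
    by blast
  then have "openin (relabel f X) (f ` topspace X)"
    by (simp add: openin_relabel)
  then show ?thesis
    using openin_subset openin_relabel[of f X "topspace (relabel f X)"] by fastforce
qed

lemma homeomorphic_map_relabel:
  "inj_on f (topspace X) \<Longrightarrow> homeomorphic_map X (relabel f X) f"
  by (auto simp: homeomorphic_map_def quotient_map_def topspace_relabel openin_relabel)

lemma relabel_eq_if_homeomorphic_map:
  assumes "homeomorphic_map X Y f"
  shows "relabel f X = Y"
proof -
  have q: "quotient_map X Y f"
    using assms by (simp add: homeomorphic_map_def)
  have "openin (relabel f X) U \<longleftrightarrow> openin Y U" for U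
    using q openin_subset[of Y U] by (auto simp: quotient_map_def openin_relabel)
  then show ?thesis
    by (simp add: topology_eq)
qed

lemma relabel_cong:
  assumes "\<And>x. x \<in> topspace X \<Longrightarrow> f x = g x"
  shows "relabel f X = relabel g X"
proof -
  have "{x \<in> topspace X. f x \<in> U} = {x \<in> topspace X. g x \<in> U}" for U
    using assms by auto
  moreover have "f ` topspace X = g ` topspace X"
    using assms by (rule image_cong[OF refl])
  ultimately show ?thesis
    by (simp add: relabel_def)
qed

lemma homeomorphic_space_iff_relabel:
  "X homeomorphic_space Y \<longleftrightarrow> (\<exists>f. inj_on f (topspace X) \<and> Y = relabel f X)"
  using homeomorphic_map_relabel relabel_eq_if_homeomorphic_map homeomorphic_imp_injective_map
  unfolding homeomorphic_space by blast

lemma finite_t0_space_homeomorphic: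
  assumes "X homeomorphic_space Y" "finite_t0_space X"
  shows "finite_t0_space Y"
proof -
  obtain f where "homeomorphic_map X Y f"
    using assms(1) homeomorphic_space by blast
  then have "topspace Y = f ` topspace X"
    using homeomorphic_imp_surjective_map by blast
  then show ?thesis
    using assms homeomorphic_t0_space by (auto simp: finite_t0_space_def)
qed

section \<open>Collapses of spaces under relabelling\<close>

lemma weak_point_homeomorphic_map:
  assumes f: "homeomorphic_map X Y f" and X: "finite_t0_space X" and x: "weak_point X x"
  shows "weak_point Y (f x)"
proof -
  have Y: "finite_t0_space Y"
    using f X finite_t0_space_homeomorphic homeomorphic_space by blast
  have fX: "topspace Y = f ` topspace X" and inj: "inj_on f (topspace X)"
    using homeomorphic_imp_surjective_map[OF f] homeomorphic_imp_injective_map[OF f] by auto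
  have xX: "x \<in> topspace X"
    using x by (simp add: weak_point_def)
  have eq: "strict_lower Y (f x) = f ` strict_lower X x" "strict_upper Y (f x) = f ` strict_upper X x"
    using xX inj point_le_homeomorphic_map[OF f X]
    by (auto simp: strict_lower_def strict_upper_def fX inj_on_def)
  have "contractible_space (subtopology Y (f ` S)) \<longleftrightarrow> contractible_space (subtopology X S)"
    if "S \<subseteq> topspace X" for S
  proof -
    have "homeomorphic_map (subtopology X S) (subtopology Y (f ` S)) f"
      using that fX by (intro homeomorphic_map_subtopologies[OF f]) auto
    then show ?thesis
      using homeomorphic_space homeomorphic_space_contractibility by blast
  qed
  then show ?thesis
    using x xX unfolding weak_point_iff[OF X] weak_point_iff[OF Y] eq fX
    by (simp add: strict_lower_def strict_upper_def)
qed

lemma elementary_space_collapse_finite_t0: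
  "elementary_space_collapse X Y \<Longrightarrow> finite_t0_space X \<and> finite_t0_space Y"
  by (auto simp: elementary_space_collapse_def finite_t0_space_subtopology)

lemma space_collapse_finite_t0:
  assumes "space_collapse X Y" "finite_t0_space X"
  shows "finite_t0_space Y"
  using assms unfolding space_collapse_def
  by induction (auto dest: elementary_space_collapse_finite_t0)

lemma elementary_space_collapse_relabel:
  assumes "elementary_space_collapse X Y" "inj_on f (topspace X)"
  shows "elementary_space_collapse (relabel f X) (relabel f Y)"
proof -
  obtain x where X: "finite_t0_space X" and x: "weak_point X x"
    and Y: "Y = subtopology X (topspace X - {x})"
    using assms(1) by (auto simp: elementary_space_collapse_def)
  have f: "homeomorphic_map X (relabel f X) f"
    using homeomorphic_map_relabel[OF assms(2)] .
  have "x \<in> topspace X"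
    using x by (simp add: weak_point_def)
  then have "f ` (topspace X \<inter> (topspace X - {x})) = f ` topspace X - {f x}"
    using inj_on_image_set_diff[OF assms(2), of "topspace X" "{x}"] by auto
  then have "homeomorphic_map Y (subtopology (relabel f X) (topspace (relabel f X) - {f x})) f"
    unfolding Y by (intro homeomorphic_map_subtopologies[OF f]) (auto simp: topspace_relabel)
  then have "relabel f Y = subtopology (relabel f X) (topspace (relabel f X) - {f x})"
    by (rule relabel_eq_if_homeomorphic_map)
  moreover have "weak_point (relabel f X) (f x)"
    using weak_point_homeomorphic_map[OF f X x] .
  moreover have "finite_t0_space (relabel f X)"
    using f X finite_t0_space_homeomorphic homeomorphic_space by blast
  ultimately show ?thesis
    unfolding elementary_space_collapse_def by blast
qed

lemma space_collapse_topspace: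
  assumes "space_collapse X Y"
  shows "topspace Y \<subseteq> topspace X"
  using assms unfolding space_collapse_def
  by induction (auto simp: elementary_space_collapse_def)

lemma space_collapse_relabel:
  assumes "space_collapse X Y" "inj_on f (topspace X)"
  shows "space_collapse (relabel f X) (relabel f Y)"
  using assms unfolding space_collapse_def
proof (induction rule: converse_rtranclp_induct)
  case (step X Z)
  then have "elementary_space_collapse (relabel f X) (relabel f Z)"
    by (intro elementary_space_collapse_relabel)
  moreover have "inj_on f (topspace Z)"
    using step by (intro inj_on_subset[OF step.prems]) (auto simp: elementary_space_collapse_def)
  ultimately show ?case
    using step.IH by (meson converse_rtranclp_into_rtranclp)
qed simp

lemma finite_t0_space_relabel:
  assumes "finite_t0_space X" "inj_on f (topspace X)"
  shows "finite_t0_space (relabel f X)"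
  using assms homeomorphic_space_iff_relabel finite_t0_space_homeomorphic by blast

lemma space_step_relabel:
  assumes "space_step X Y" "inj_on f (topspace X \<union> topspace Y)"
  shows "space_step (relabel f X) (relabel f Y)"
proof -
  have "inj_on f (topspace X)" "inj_on f (topspace Y)"
    using assms(2) by (auto intro: inj_on_subset)
  then show ?thesis
    using assms(1) space_collapse_relabel[of X Y f] space_collapse_relabel[of Y X f]
      finite_t0_space_relabel[of X f] finite_t0_space_relabel[of Y f]
    unfolding space_step_def by blast
qed

text \<open>The counterpart of \<open>complex_steps_transfer\<close>: the homeomorphism is extended
  before each step to the points that an expansion may add.\<close>

lemma space_steps_transfer:
  fixes X Y X' :: "nat topology"
  assumes "space_step\<^sup>*\<^sup>* X Y" "X homeomorphic_space X'"
  shows "\<exists>Y'. space_step\<^sup>*\<^sup>* X' Y' \<and> Y homeomorphic_space Y'"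
  using assms
proof (induction arbitrary: X' rule: converse_rtranclp_induct)
  case (step X Z)
  obtain h where h: "inj_on h (topspace X)" "X' = relabel h X"
    using step.prems homeomorphic_space_iff_relabel by blast
  have "finite (topspace X)"
    using step.hyps(1) by (auto simp: space_step_def finite_t0_space_def)
  then obtain g where g: "inj_on g (topspace X \<union> topspace Z)" "\<And>x. x \<in> topspace X \<Longrightarrow> g x = h x"
    using inj_on_extend[OF _ h(1)] by blast
  have "X' = relabel g X"
    unfolding h(2) using g(2) by (intro relabel_cong) simp
  then have "space_step X' (relabel g Z)"
    using space_step_relabel[OF step.hyps(1) g(1)] by simp
  moreover have "Z homeomorphic_space relabel g Z"
    using g(1) homeomorphic_space_iff_relabel inj_on_subset by blast
  ultimately show ?case
    using step.IH by (meson converse_rtranclp_into_rtranclp)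
qed blast

section \<open>Simple equivalence as an equivalence relation\<close>

lemma simply_equivalent_sym:
  assumes "simply_equivalent X Y"
  shows "simply_equivalent Y X"
proof -
  have "space_step\<inverse>\<inverse> = space_step"
    by (auto simp: space_step_def fun_eq_iff)
  then have "space_step\<^sup>*\<^sup>* Y' X'" if "space_step\<^sup>*\<^sup>* X' Y'" for X' Y' :: "nat topology"
    using that by (metis conversepI rtranclp_conversep)
  then show ?thesis
    using assms homeomorphic_space_sym unfolding simply_equivalent_def by meson
qed

lemma simply_equivalent_trans:
  assumes "simply_equivalent X Y" "simply_equivalent Y Z"
  shows "simply_equivalent X Z"
proof -
  obtain X' Y' :: "nat topology"
    where 1: "X homeomorphic_space X'" "space_step\<^sup>*\<^sup>* X' Y'" "Y' homeomorphic_space Y"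
    using assms(1) by (auto simp: simply_equivalent_def)
  obtain Y'' Z' :: "nat topology"
    where 2: "Y homeomorphic_space Y''" "space_step\<^sup>*\<^sup>* Y'' Z'" "Z' homeomorphic_space Z"
    using assms(2) by (auto simp: simply_equivalent_def)
  have "Y'' homeomorphic_space Y'"
    using 1(3) 2(1) homeomorphic_space_sym homeomorphic_space_trans by blast
  then obtain Z'' where Z'': "space_step\<^sup>*\<^sup>* Y' Z''" "Z' homeomorphic_space Z''"
    using space_steps_transfer[OF 2(2)] by blast
  then have "Z'' homeomorphic_space Z"
    using 2(3) homeomorphic_space_sym homeomorphic_space_trans by blast
  then show ?thesis
    using 1 Z'' assms unfolding simply_equivalent_def by (meson rtranclp_trans)
qed

lemma exists_nat_space:
  assumes "finite_t0_space X"
  obtains X' :: "nat topology" where "X homeomorphic_space X'" "finite_t0_space X'"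
proof -
  obtain f :: "'a \<Rightarrow> nat" where "inj_on f (topspace X)"
    using finite_imp_inj_to_nat_seg[OF finite_t0_spaceD(1)[OF assms]] by blast
  then show ?thesis
    using that[of "relabel f X"] finite_t0_space_relabel[OF assms] homeomorphic_space_iff_relabel
    by blast
qed

lemma homeomorphic_imp_simply_equivalent:
  assumes "X homeomorphic_space Y" "finite_t0_space X"
  shows "simply_equivalent X Y"
proof -
  obtain X' :: "nat topology" where X': "X homeomorphic_space X'"
    using exists_nat_space[OF assms(2)] by blast
  then have "X' homeomorphic_space Y"
    using assms(1) homeomorphic_space_sym homeomorphic_space_trans by blast
  then show ?thesis
    using X' assms finite_t0_space_homeomorphic unfolding simply_equivalent_def by blast
qed

lemma space_collapse_imp_simply_equivalent:
  assumes "space_collapse X Y" "finite_t0_space X"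
  shows "simply_equivalent X Y"
proof -
  have Y: "finite_t0_space Y" "topspace Y \<subseteq> topspace X"
    using space_collapse_finite_t0[OF assms] space_collapse_topspace[OF assms(1)] by auto
  obtain f :: "'a \<Rightarrow> nat" where f: "inj_on f (topspace X)"
    using finite_imp_inj_to_nat_seg[OF finite_t0_spaceD(1)[OF assms(2)]] by blast
  have fY: "inj_on f (topspace Y)"
    using inj_on_subset[OF f Y(2)] .
  have "space_step (relabel f X) (relabel f Y)"
    using space_collapse_relabel[OF assms(1) f] finite_t0_space_relabel assms(2) Y(1) f fY
    by (auto simp: space_step_def)
  moreover have "X homeomorphic_space relabel f X" "relabel f Y homeomorphic_space Y"
    using f fY homeomorphic_space_iff_relabel homeomorphic_space_sym by blast+
  ultimately show ?thesis
    using assms(2) Y(1) unfolding simply_equivalent_def by blast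
qed

text \<open>The set \<open>S\<close> is what is still left of \<open>R\<close>. Asking for a weak
  point in every nonempty remainder lets the next point to be removed depend on \<open>S\<close>;
  for the mapping cylinder it is a minimal or a maximal point of \<open>S\<close>.\<close>

lemma space_collapse_remove_set:
  assumes "finite_t0_space X" "R \<subseteq> topspace X"
    and "\<And>S. S \<subseteq> R \<Longrightarrow> S \<noteq> {} \<Longrightarrow> \<exists>x\<in>S. weak_point (subtopology X (topspace X - R \<union> S)) x"
  shows "space_collapse X (subtopology X (topspace X - R))"
proof -
  have "space_collapse (subtopology X (topspace X - R \<union> S)) (subtopology X (topspace X - R))"
    if "S \<subseteq> R" for S
    using finite_subset[OF that finite_subset[OF assms(2) finite_t0_spaceD(1)[OF assms(1)]]] that
  proof (induction "card S" arbitrary: S)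
    case (Suc n)
    then have "S \<noteq> {}"
      by auto
    then obtain x where x: "x \<in> S" "weak_point (subtopology X (topspace X - R \<union> S)) x"
      using assms(3) Suc.prems by blast
    let ?Y = "subtopology X (topspace X - R \<union> (S - {x}))"
    have "(topspace X - R \<union> S) \<inter> (topspace (subtopology X (topspace X - R \<union> S)) - {x}) =
        topspace X - R \<union> (S - {x})"
      using x Suc.prems assms(2) by auto
    then have "elementary_space_collapse (subtopology X (topspace X - R \<union> S)) ?Y"
      unfolding elementary_space_collapse_def
      using x finite_t0_space_subtopology[OF assms(1)] by (metis subtopology_subtopology)
    moreover have "space_collapse ?Y (subtopology X (topspace X - R))"
      using Suc x by (intro Suc.hyps(1)) auto
    ultimately show ?case
      unfolding space_collapse_def by (rule converse_rtranclp_into_rtranclp)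
  qed (simp add: space_collapse_def)
  moreover have "topspace X - R \<union> R = topspace X"
    using assms(2) by auto
  ultimately show ?thesis
    using subtopology_topspace[of X] by (metis order_refl)
qed

section \<open>Order complexes\<close>

text \<open>The clique complex (flag complex) of a graph. Order complexes have this form, and the
  collapse below uses the comparability graph without the direction of the order.\<close>

definition cliques :: "('a \<Rightarrow> 'a \<Rightarrow> bool) \<Rightarrow> 'a set \<Rightarrow> 'a set set" where
  "cliques R A = {C. C \<subseteq> A \<and> C \<noteq> {} \<and> (\<forall>x\<in>C. \<forall>y\<in>C. R x y)}"

lemma finite_complex_cliques: "finite A \<Longrightarrow> finite_complex (cliques R A)"
  unfolding finite_complex_def cliques_def by (auto intro: finite_subset)

lemma insert_in_cliques:
  assumes "C \<in> cliques R A" "y \<in> A" "\<And>z. z \<in> C \<Longrightarrow> R y z"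
    and "\<And>x. R x x" and "\<And>x y. R x y \<Longrightarrow> R y x"
  shows "insert y C \<in> cliques R A"
  using assms by (simp add: cliques_def)

lemma order_complex_eq_cliques: "order_complex X = cliques (comparable X) (topspace X)"
  by (auto simp: order_complex_def cliques_def chain_def comparable_def)

text \<open>If \<open>w\<close> is removed from \<open>W\<close> because it is dominated by \<open>y\<close>, then the link of the edge
  \<open>{x, w}\<close> is a cone with apex \<open>y\<close>, so the simplices containing this edge can be collapsed.\<close>

lemma simplicial_collapse_cliques:
  assumes "dismantlable R W" and A: "finite A" and refl: "\<And>x. R x x"
    and sym: "\<And>x y. R x y \<Longrightarrow> R y x" and "x \<in> A" "W \<subseteq> A - {x}" "N \<inter> W = {}" "x \<notin> N"
    and "\<And>w. w \<in> W \<Longrightarrow> R x w" and "\<And>n w. n \<in> N \<Longrightarrow> w \<in> W \<Longrightarrow> R n w"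
  shows "simplicial_collapse {C \<in> cliques R A. x \<in> C \<longrightarrow> C \<subseteq> insert x (W \<union> N)} (cliques R (A - {x}))"
  using assms(1,5-10)
proof (induction rule: dismantlable.induct)
  case (single w)
  \<comment> \<open>Only \<open>w\<close> and \<open>N\<close> are left in the link of
    \<open>x\<close>. Since \<open>w\<close> is adjacent to \<open>x\<close> and to all of
    \<open>N\<close>, the link is a cone with apex \<open>w\<close>, and the whole open star of
    \<open>x\<close> collapses.\<close>
  let ?K = "{C \<in> cliques R A. x \<in> C \<longrightarrow> C \<subseteq> insert x ({w} \<union> N)}"
  have "finite_complex ?K"
    by (rule finite_complex_subcomplex[OF finite_complex_cliques[OF A, of R]]) auto
  moreover have "insert w C \<in> ?K" if "C \<in> ?K" "{x} \<subseteq> C" for C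
  proof -
    have C: "C \<subseteq> insert x ({w} \<union> N)" "C \<in> cliques R A"
      using that by auto
    have "R w z" if "z \<in> C" for z
      using that C(1) single.prems refl sym by blast
    then show ?thesis
      using insert_in_cliques[OF C(2) _ _ refl sym] C(1) single.prems by auto
  qed
  ultimately have "simplicial_collapse ?K {C \<in> ?K. \<not> {x} \<subseteq> C}"
    using single.prems by (intro simplicial_collapse_open_star[of _ _ w]) auto
  moreover have "{C \<in> ?K. \<not> {x} \<subseteq> C} = cliques R (A - {x})"
    by (auto simp: cliques_def)
  ultimately show ?case
    by simp
next
  case (remove w W y)
  let ?K = "{C \<in> cliques R A. x \<in> C \<longrightarrow> C \<subseteq> insert x (W \<union> N)}"
  have "finite_complex ?K"
    by (rule finite_complex_subcomplex[OF finite_complex_cliques[OF A, of R]]) auto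
  moreover have "insert y C \<in> ?K" if "C \<in> ?K" "{x, w} \<subseteq> C" for C
  proof -
    have C: "C \<subseteq> insert x (W \<union> N)" "C \<in> cliques R A"
      using that by auto
    \<comment> \<open>For \<open>z\<close> in \<open>W\<close> this is domination of
      \<open>w\<close> by \<open>y\<close>. For \<open>z = x\<close> or \<open>z\<close> in
      \<open>N\<close> it holds because \<open>y\<close> is in \<open>W\<close>, whose points are
      all adjacent to \<open>x\<close> and to \<open>N\<close>.\<close>
    have "R y z" if "z \<in> C" for z
    proof -
      have "R w z"
        using C(2) \<open>{x, w} \<subseteq> C\<close> that by (auto simp: cliques_def)
      then show ?thesis
        using C(1) that remove.hyps(2,4) remove.prems(5,6) sym by blast
    qed
    then show ?thesis
      using insert_in_cliques[OF C(2) _ _ refl sym] C(1) remove.hyps(2) remove.prems(2) by auto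
  qed
  ultimately have star: "simplicial_collapse ?K {C \<in> ?K. \<not> {x, w} \<subseteq> C}"
    using remove by (intro simplicial_collapse_open_star[of _ _ y]) auto
  \<comment> \<open>Since \<open>w\<close> is neither \<open>x\<close> nor in \<open>N\<close>, the
    simplices through \<open>x\<close> that avoid \<open>w\<close> are those whose other vertices
    lie in \<open>W - {w}\<close> or \<open>N\<close>.\<close>
  have eq: "{C \<in> ?K. \<not> {x, w} \<subseteq> C} =
      {C \<in> cliques R A. x \<in> C \<longrightarrow> C \<subseteq> insert x (W - {w} \<union> N)}"
    using remove by auto
  have "simplicial_collapse {C \<in> cliques R A. x \<in> C \<longrightarrow> C \<subseteq> insert x (W - {w} \<union> N)}
      (cliques R (A - {x}))"
    using remove.prems by (intro remove.IH) auto
  then show ?case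
    by (rule simplicial_collapse_trans[OF star[unfolded eq]])
qed

lemma contractible_subtopology_imp_dismantlable:
  assumes X: "finite_t0_space X" and W: "W \<subseteq> topspace X" "W \<noteq> {}"
    and c: "contractible_space (subtopology X W)"
  shows "dismantlable (comparable X) W"
proof -
  have top: "topspace (subtopology X W) = W"
    using W(1) by auto
  have "dismantlable (comparable (subtopology X W)) W"
    using contractible_imp_dismantlable[OF finite_t0_space_subtopology[OF X] c] W(2)
    unfolding top .
  then show ?thesis
  proof (rule dismantlable_cong)
    fix x y assume "x \<in> W" "y \<in> W"
    then have "x \<in> topspace X \<inter> W" "y \<in> topspace X \<inter> W"
      using W(1) by auto
    then show "comparable (subtopology X W) x y \<longleftrightarrow> comparable X x y"
      using point_le_subtopology[OF X] by (simp add: comparable_def)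
  qed
qed

text \<open>The contractible one of the two sets becomes \<open>W\<close> in
  \<open>simplicial_collapse_cliques\<close> and is dismantled; the other becomes \<open>N\<close>
  and is carried along unchanged, as every point below \<open>x\<close> is comparable with every
  point above \<open>x\<close>.\<close>

lemma order_complex_remove_weak_point:
  assumes X: "finite_t0_space X" and x: "weak_point X x"
  shows "simplicial_collapse (order_complex X) (order_complex (subtopology X (topspace X - {x})))"
proof -
  have sub: "strict_lower X x \<subseteq> topspace X - {x}" "strict_upper X x \<subseteq> topspace X - {x}"
    by (auto simp: strict_lower_def strict_upper_def)
  have xX: "x \<in> topspace X"
    using x by (simp add: weak_point_def)
  have disj: "strict_lower X x \<inter> strict_upper X x = {}"
    using xX point_le_antisym[OF X, of x] by (auto simp: strict_lower_def strict_upper_def)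
  have join: "comparable X n w" if "n \<in> strict_lower X x" "w \<in> strict_upper X x" for n w
    using that point_le_trans[of X n x w] by (auto simp: comparable_def strict_lower_def strict_upper_def)
  have sym: "comparable X a b \<Longrightarrow> comparable X b a" for a b
    by (auto simp: comparable_def)
  have refl: "comparable X a a" for a
    by (simp add: comparable_def point_le_refl)
  have comp: "comparable X x w" if "w \<in> strict_lower X x \<union> strict_upper X x" for w
    using that by (auto simp: comparable_def strict_lower_def strict_upper_def)
  have "C \<subseteq> insert x (strict_lower X x \<union> strict_upper X x)"
    if "C \<in> cliques (comparable X) (topspace X)" "x \<in> C" for C
    using that by (auto simp: cliques_def comparable_def strict_lower_def strict_upper_def)
  then have eq: "order_complex X = {C \<in> cliques (comparable X) (topspace X).
      x \<in> C \<longrightarrow> C \<subseteq> insert x (strict_lower X x \<union> strict_upper X x)}"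
    unfolding order_complex_eq_cliques by blast
  have eq': "order_complex (subtopology X (topspace X - {x})) =
      cliques (comparable X) (topspace X - {x})"
  proof -
    have "comparable (subtopology X (topspace X - {x})) a b \<longleftrightarrow> comparable X a b"
      if "a \<in> topspace X - {x}" "b \<in> topspace X - {x}" for a b
      using that point_le_subtopology[OF X] by (simp add: comparable_def)
    moreover have "topspace (subtopology X (topspace X - {x})) = topspace X - {x}"
      by auto
    ultimately show ?thesis
      unfolding order_complex_eq_cliques cliques_def by (metis (no_types, opaque_lifting) subsetD)
  qed
  note fin = finite_t0_spaceD(1)[OF X]
  from x consider
    "dismantlable (comparable X) (strict_lower X x)" | "dismantlable (comparable X) (strict_upper X x)"
    unfolding weak_point_iff[OF X]
    using contractible_subtopology_imp_dismantlable[OF X] sub by blast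
  then show ?thesis
  proof cases
    case 1
    show ?thesis
      unfolding eq eq'
      by (rule simplicial_collapse_cliques[OF 1 fin refl sym xX]) (use sub disj comp join sym in auto)
  next
    case 2
    show ?thesis
      unfolding eq eq' Un_commute[of "strict_lower X x"]
      by (rule simplicial_collapse_cliques[OF 2 fin refl sym xX]) (use sub disj comp join in auto)
  qed
qed

lemma order_complex_collapse:
  assumes "space_collapse X Y"
  shows "simplicial_collapse (order_complex X) (order_complex Y)"
  using assms unfolding space_collapse_def
proof (induction rule: rtranclp_induct)
  case (step Y Z)
  then have "simplicial_collapse (order_complex Y) (order_complex Z)"
    using order_complex_remove_weak_point by (auto simp: elementary_space_collapse_def)
  then show ?case
    using step.IH simplicial_collapse_trans by blast
qed (simp add: simplicial_collapse_def)

lemma finite_complex_order_complex: "finite_t0_space X \<Longrightarrow> finite_complex (order_complex X)"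
  by (simp add: order_complex_eq_cliques finite_complex_cliques finite_t0_spaceD)

lemma order_complex_homeomorphic:
  assumes "X homeomorphic_space Y" "finite_t0_space X"
  shows "complex_iso (order_complex X) (order_complex Y)"
proof -
  obtain f where f: "homeomorphic_map X Y f"
    using assms(1) homeomorphic_space by blast
  have fX: "topspace Y = f ` topspace X" and inj: "inj_on f (topspace X)"
    using homeomorphic_imp_surjective_map[OF f] homeomorphic_imp_injective_map[OF f] by auto
  have comp: "comparable Y (f x) (f y) \<longleftrightarrow> comparable X x y"
    if "x \<in> topspace X" "y \<in> topspace X" for x y
    using that point_le_homeomorphic_map[OF f assms(2)] by (simp add: comparable_def)
  have "order_complex Y = (`) f ` order_complex X"
  proof (intro equalityI subsetI)
    fix C assume C: "C \<in> order_complex Y"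
    define D where "D = {x \<in> topspace X. f x \<in> C}"
    have CD: "C = f ` D"
      using C fX by (auto simp: D_def order_complex_eq_cliques cliques_def)
    moreover have "comparable X x y" if "x \<in> D" "y \<in> D" for x y
      using that C comp[of x y] by (simp add: order_complex_eq_cliques cliques_def D_def)
    ultimately have "D \<in> order_complex X"
      using C by (auto simp: order_complex_eq_cliques cliques_def D_def)
    then show "C \<in> (`) f ` order_complex X"
      using CD by blast
  next
    fix C assume "C \<in> (`) f ` order_complex X"
    then obtain D where D: "C = f ` D" "D \<subseteq> topspace X" "D \<noteq> {}"
      and DD: "\<And>x y. x \<in> D \<Longrightarrow> y \<in> D \<Longrightarrow> comparable X x y"
      by (auto simp: order_complex_eq_cliques cliques_def)
    have "comparable Y (f x) (f y)" if "x \<in> D" "y \<in> D" for x y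
      using that DD comp D(2) by blast
    then show "C \<in> order_complex Y"
      using D fX by (auto simp: order_complex_eq_cliques cliques_def)
  qed
  moreover have "inj_on f (\<Union>(order_complex X))"
    by (rule inj_on_subset[OF inj]) (auto simp: order_complex_def)
  ultimately show ?thesis
    unfolding complex_iso_iff by blast
qed

lemma order_complex_simply_equivalent:
  assumes "simply_equivalent X Y"
  shows "same_simple_homotopy_type (order_complex X) (order_complex Y)"
proof -
  obtain X' Y' :: "nat topology"
    where XY: "X homeomorphic_space X'" "space_step\<^sup>*\<^sup>* X' Y'" "Y' homeomorphic_space Y"
    and X: "finite_t0_space X"
    using assms by (auto simp: simply_equivalent_def)
  have X': "finite_t0_space X'"
    using XY X finite_t0_space_homeomorphic by blast
  have steps: "same_simple_homotopy_type (order_complex A) (order_complex B)"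
    if "space_step A B" for A B :: "nat topology"
    using that order_complex_collapse finite_complex_order_complex
      simplicial_collapse_imp_same_simple_homotopy_type same_simple_homotopy_type_sym
    unfolding space_step_def by metis
  have "finite_t0_space Y' \<and> same_simple_homotopy_type (order_complex X') (order_complex Y')"
    using XY(2)
  proof induction
    case base
    then show ?case
      using X' complex_iso_refl complex_iso_imp_same_simple_homotopy_type finite_complex_order_complex
      by blast
  next
    case (step A B)
    then show ?case
      using steps same_simple_homotopy_type_trans
      unfolding space_step_def by blast
  qed
  then show ?thesis
    using XY X order_complex_homeomorphic complex_iso_imp_same_simple_homotopy_type
      finite_complex_order_complex same_simple_homotopy_type_trans by meson
qed

section \<open>Posets as spaces\<close>

text \<open>The Alexandrov topology with down-sets as open sets, the encoding that
  \<open>face_space\<close> also uses. It turns the order on the mapping cylinder into a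
  space.\<close>

definition down_topology :: "'a set \<Rightarrow> ('a \<Rightarrow> 'a \<Rightarrow> bool) \<Rightarrow> 'a topology" where
  "down_topology A le = topology (\<lambda>U. U \<subseteq> A \<and> (\<forall>y\<in>U. \<forall>x\<in>A. le x y \<longrightarrow> x \<in> U))"

lemma openin_down_topology:
  "openin (down_topology A le) U \<longleftrightarrow> U \<subseteq> A \<and> (\<forall>y\<in>U. \<forall>x\<in>A. le x y \<longrightarrow> x \<in> U)"
proof -
  have "istopology (\<lambda>U. U \<subseteq> A \<and> (\<forall>y\<in>U. \<forall>x\<in>A. le x y \<longrightarrow> x \<in> U))"
    unfolding istopology_def by blast
  then show ?thesis
    by (simp add: down_topology_def)
qed

lemma topspace_down_topology: "topspace (down_topology A le) = A"
  unfolding topspace_def openin_down_topology by blast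

lemma point_le_down_topology:
  assumes "x \<in> A" "y \<in> A" and "\<And>x. x \<in> A \<Longrightarrow> le x x"
    and "\<And>x y z. x \<in> A \<Longrightarrow> y \<in> A \<Longrightarrow> z \<in> A \<Longrightarrow> le x y \<Longrightarrow> le y z \<Longrightarrow> le x z"
  shows "point_le (down_topology A le) x y \<longleftrightarrow> le x y"
proof
  have "openin (down_topology A le) {z \<in> A. le z y}"
    unfolding openin_down_topology
  proof (intro conjI ballI impI)
    fix z x assume "z \<in> {z \<in> A. le z y}" "x \<in> A" "le x z"
    then show "x \<in> {z \<in> A. le z y}"
      using assms(4)[of x z y] assms(2) by simp
  qed simp
  then have "min_open (down_topology A le) y \<subseteq> {z \<in> A. le z y}"
    using assms(2,3) by (intro min_open_subset) auto
  moreover assume "point_le (down_topology A le) x y"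
  ultimately show "le x y"
    by (auto simp: point_le_def)
next
  assume "le x y"
  then have "x \<in> U" if "openin (down_topology A le) U" "y \<in> U" for U
    using that assms(1) unfolding openin_down_topology by blast
  then show "point_le (down_topology A le) x y"
    by (simp add: point_le_def min_open_def)
qed

lemma finite_t0_space_if_antisym:
  assumes "finite (topspace X)"
    and "\<And>x y. x \<in> topspace X \<Longrightarrow> y \<in> topspace X \<Longrightarrow> point_le X x y \<Longrightarrow> point_le X y x \<Longrightarrow> x = y"
  shows "finite_t0_space X"
  unfolding finite_t0_space_def t0_space_def
proof (intro conjI ballI impI assms(1))
  fix x y assume "x \<in> topspace X" "y \<in> topspace X" "x \<noteq> y"
  then have "\<not> point_le X x y \<or> \<not> point_le X y x"
    using assms(2) by blast
  then show "\<exists>U. openin X U \<and> (x \<notin> U \<longleftrightarrow> y \<in> U)"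
    by (auto simp: point_le_def min_open_def)
qed

lemma finite_t0_space_face_space: "finite_complex K \<Longrightarrow> finite_t0_space (face_space K)"
  by (rule finite_t0_space_if_antisym) (auto simp: point_le_face_space finite_complexD(1))

lemma order_iso_imp_homeomorphic_space:
  assumes X: "finite_t0_space X" and Y: "finite_t0_space Y"
    and f: "bij_betw f (topspace X) (topspace Y)"
    and le: "\<And>x y. x \<in> topspace X \<Longrightarrow> y \<in> topspace X \<Longrightarrow> point_le Y (f x) (f y) \<longleftrightarrow> point_le X x y"
  shows "X homeomorphic_space Y"
proof -
  let ?g = "the_inv_into (topspace X) f"
  have g: "?g y \<in> topspace X" "f (?g y) = y" if "y \<in> topspace Y" for y
    using f that by (auto simp: bij_betw_def the_inv_into_into f_the_inv_into_f)
  have "continuous_map X Y f"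
    using f le by (intro monotone_imp_continuous[OF X Y]) (auto simp: bij_betw_def)
  moreover have "point_le X (?g x) (?g y)" if "x \<in> topspace Y" "y \<in> topspace Y" "point_le Y x y" for x y
    using le[OF g(1)[OF that(1)] g(1)[OF that(2)]] that by (simp add: g(2))
  then have "continuous_map Y X ?g"
    using g(1) by (intro monotone_imp_continuous[OF Y X]) auto
  ultimately show ?thesis
    using f g unfolding homeomorphic_space_def homeomorphic_maps_def
    by (metis bij_betw_def the_inv_into_f_f)
qed

section \<open>Criteria for weak points\<close>

lemma contractible_subtopology_if_conical:
  assumes Z: "finite_t0_space Z" and W: "W \<subseteq> topspace Z" and p: "p \<in> W"
    and f: "\<And>x. x \<in> W \<Longrightarrow> f x \<in> W"
    and mono: "\<And>x y. x \<in> W \<Longrightarrow> y \<in> W \<Longrightarrow> point_le Z x y \<Longrightarrow> point_le Z (f x) (f y)"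
    and le: "\<And>x. x \<in> W \<Longrightarrow> point_le Z x (f x) \<and> point_le Z p (f x)"
  shows "contractible_space (subtopology Z W)"
proof -
  have top: "topspace (subtopology Z W) = W"
    using W by auto
  have sub: "point_le (subtopology Z W) x y \<longleftrightarrow> point_le Z x y" if "x \<in> W" "y \<in> W" for x y
    using that W by (intro point_le_subtopology[OF Z]) auto
  show ?thesis
    by (rule contractible_if_conical[OF finite_t0_space_subtopology[OF Z], of p W f])
      (use subsetD[OF W] p f mono le in \<open>auto simp: sub\<close>)
qed

text \<open>All conditions refer to the order of the ambient space \<open>Z\<close>, so in a series
  of removals the orders of the intermediate subspaces never have to be computed.\<close>

lemma weak_point_if_conical_lower:
  assumes Z: "finite_t0_space Z" and T: "T \<subseteq> topspace Z" "x \<in> T"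
    and W: "W = {y \<in> T. y \<noteq> x \<and> point_le Z y x}" and p: "p \<in> W"
    and f: "\<And>x. x \<in> W \<Longrightarrow> f x \<in> W"
    and mono: "\<And>x y. x \<in> W \<Longrightarrow> y \<in> W \<Longrightarrow> point_le Z x y \<Longrightarrow> point_le Z (f x) (f y)"
    and le: "\<And>x. x \<in> W \<Longrightarrow> point_le Z x (f x) \<and> point_le Z p (f x)"
  shows "weak_point (subtopology Z T) x"
proof -
  let ?Y = "subtopology Z T"
  have top: "topspace ?Y = T"
    using T by auto
  have "point_le ?Y y x \<longleftrightarrow> point_le Z y x" if "y \<in> T" for y
    using that T by (intro point_le_subtopology[OF Z]) auto
  then have "strict_lower ?Y x = W"
    unfolding W strict_lower_def top by blast
  moreover have "subtopology ?Y W = subtopology Z W"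
    unfolding subtopology_subtopology by (rule arg_cong[where f = "subtopology Z"]) (auto simp: W)
  moreover have "contractible_space (subtopology Z W)"
    by (rule contractible_subtopology_if_conical[OF Z _ p f mono le]) (use W T in auto)
  ultimately show ?thesis
    using weak_point_iff[OF finite_t0_space_subtopology[OF Z], of T x] T(2) p top by auto
qed

text \<open>A poset with a least point \<open>p\<close> is conical with the identity as the
  map.\<close>

lemma weak_point_if_upper_least:
  assumes Z: "finite_t0_space Z" and T: "T \<subseteq> topspace Z" "x \<in> T"
    and p: "p \<in> T" "p \<noteq> x" "point_le Z x p"
    and le: "\<And>y. y \<in> T \<Longrightarrow> y \<noteq> x \<Longrightarrow> point_le Z x y \<Longrightarrow> point_le Z p y"
  shows "weak_point (subtopology Z T) x"
proof -
  let ?Y = "subtopology Z T" and ?W = "{y \<in> T. y \<noteq> x \<and> point_le Z x y}"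
  have top: "topspace ?Y = T"
    using T by auto
  have "point_le ?Y x y \<longleftrightarrow> point_le Z x y" if "y \<in> T" for y
    using that T by (intro point_le_subtopology[OF Z]) auto
  then have "strict_upper ?Y x = ?W"
    unfolding strict_upper_def top by blast
  moreover have "subtopology ?Y ?W = subtopology Z ?W"
    unfolding subtopology_subtopology by (rule arg_cong[where f = "subtopology Z"]) auto
  moreover have "contractible_space (subtopology Z ?W)"
    by (rule contractible_subtopology_if_conical[OF Z, of _ p "\<lambda>x. x"])
      (use T p le in \<open>auto simp: point_le_refl\<close>)
  ultimately show ?thesis
    using weak_point_iff[OF finite_t0_space_subtopology[OF Z], of T x] T(2) p top by auto
qed

section \<open>Face posets\<close>

lemma subtopology_face_space:
  assumes "L \<subseteq> K"
  shows "subtopology (face_space K) L = face_space L"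
proof -
  have "openin (subtopology (face_space K) L) U \<longleftrightarrow> openin (face_space L) U" for U
  proof
    assume "openin (subtopology (face_space K) L) U"
    then show "openin (face_space L) U"
      using assms by (auto simp: openin_subtopology openin_face_space)
  next
    assume U: "openin (face_space L) U"
    \<comment> \<open>The down-closure of \<open>U\<close> in \<open>K\<close> is open and adds no
      simplex of \<open>L\<close>.\<close>
    then have "U = {R \<in> K. \<exists>S\<in>U. R \<subseteq> S} \<inter> L"
      using assms by (auto simp: openin_face_space)
    moreover have "openin (face_space K) {R \<in> K. \<exists>S\<in>U. R \<subseteq> S}"
      by (auto simp: openin_face_space)
    ultimately show "openin (subtopology (face_space K) L) U"
      unfolding openin_subtopology by blast
  qed
  then show ?thesis
    by (simp add: topology_eq)
qed

text \<open>The order of the two removals matters. First \<open>S\<close> goes: the only simplex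
  strictly above it is \<open>insert a S\<close>. After that, the simplices strictly below
  \<open>insert a S\<close> are the nonempty faces not containing \<open>S\<close>. As
  \<open>a\<close> is not in \<open>S\<close>, adding \<open>a\<close> keeps a face in this set, so
  the inclusions of \<open>T\<close> and \<open>{a}\<close> in \<open>insert a T\<close> make the
  set conical.\<close>

lemma face_space_elementary_collapse:
  assumes "elementary_simplicial_collapse K L"
  shows "space_collapse (face_space K) (face_space L)"
proof -
  obtain S a where K: "finite_complex K" and S: "S \<in> K" "a \<notin> S" "insert a S \<in> K"
    and L: "L = K - {S, insert a S}"
    and free: "\<And>T. T \<in> K \<Longrightarrow> S \<subseteq> T \<Longrightarrow> T = S \<or> T = insert a S"
    using assms unfolding elementary_simplicial_collapse_iff by blast
  let ?X = "face_space K" and ?M = "K - {S}"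
  note X = finite_t0_space_face_space[OF K]
  have "weak_point (subtopology ?X K) S"
  proof (rule weak_point_if_upper_least[OF X, of _ _ "insert a S"])
    fix T assume "T \<in> K" "T \<noteq> S" "point_le ?X S T"
    then show "point_le ?X (insert a S) T"
      using free[of T] S by (auto simp: point_le_face_space)
  qed (use S in \<open>auto simp: point_le_face_space\<close>)
  then have 1: "elementary_space_collapse ?X (face_space ?M)"
    unfolding elementary_space_collapse_def using X subtopology_face_space[of ?M K]
    by (auto simp: subtopology_face_space)
  let ?W = "{T \<in> ?M. T \<noteq> insert a S \<and> point_le ?X T (insert a S)}"
  have W: "T \<in> ?W \<longleftrightarrow> T \<subseteq> insert a S \<and> T \<noteq> {} \<and> \<not> S \<subseteq> T" for T
  proof
    assume "T \<in> ?W"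
    then have T: "T \<in> K" "T \<noteq> S" "T \<noteq> insert a S" "T \<subseteq> insert a S"
      using S by (auto simp: point_le_face_space)
    then show "T \<subseteq> insert a S \<and> T \<noteq> {} \<and> \<not> S \<subseteq> T"
      using free[OF T(1)] finite_complexD(3)[OF K T(1)] by blast
  next
    assume T: "T \<subseteq> insert a S \<and> T \<noteq> {} \<and> \<not> S \<subseteq> T"
    then have "T \<in> K"
      using finite_complexD(5)[OF K S(3)] by blast
    then show "T \<in> ?W"
      using T S(3) by (auto simp: point_le_face_space)
  qed
  have WK: "T \<in> K" if "T \<in> ?W" for T
    using that by blast
  have ple: "point_le ?X T T' \<longleftrightarrow> T \<subseteq> T'" if "T \<in> ?W" "T' \<in> ?W" for T T'
    using point_le_face_space[OF WK[OF that(1)] WK[OF that(2)]] .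
  have ins: "insert a T \<in> ?W" if "T \<in> ?W" for T
    using that S(2) unfolding W by blast
  have "\<not> S \<subseteq> {a}"
    using S(2) finite_complexD(3)[OF K S(1)] by blast
  then have aW: "{a} \<in> ?W"
    unfolding W by blast
  have "weak_point (subtopology ?X ?M) (insert a S)"
  proof (rule weak_point_if_conical_lower[OF X _ _ refl, of _ _ "{a}" "insert a"])
    fix T T' assume T: "T \<in> ?W" "T' \<in> ?W" "point_le ?X T T'"
    show "point_le ?X (insert a T) (insert a T')"
      unfolding ple[OF ins[OF T(1)] ins[OF T(2)]] using T(3)[unfolded ple[OF T(1,2)]] by blast
  next
    fix T assume T: "T \<in> ?W"
    show "point_le ?X T (insert a T) \<and> point_le ?X {a} (insert a T)"
      unfolding ple[OF T ins[OF T]] ple[OF aW ins[OF T]] by blast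
  qed (use S ins aW in auto)
  then have "weak_point (face_space ?M) (insert a S)"
    by (simp add: subtopology_face_space)
  moreover have "?M - {insert a S} = L"
    using L by blast
  then have "subtopology (face_space ?M) (?M - {insert a S}) = face_space L"
    using subtopology_face_space[of L ?M] by blast
  moreover have "finite_t0_space (face_space ?M)"
    using 1 elementary_space_collapse_finite_t0 by blast
  ultimately have "elementary_space_collapse (face_space ?M) (face_space L)"
    unfolding elementary_space_collapse_def by (metis topspace_face_space)
  then show ?thesis
    using 1 unfolding space_collapse_def by simp
qed

lemma face_space_collapse:
  assumes "simplicial_collapse K L"
  shows "space_collapse (face_space K) (face_space L)"
  using assms unfolding simplicial_collapse_def
proof (induction rule: rtranclp_induct)
  case (step L M)
  then show ?case
    using face_space_elementary_collapse unfolding space_collapse_def by (meson rtranclp_trans)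
qed (simp add: space_collapse_def)

lemma face_space_iso:
  assumes "complex_iso K L" "finite_complex K"
  shows "face_space K homeomorphic_space face_space L"
proof -
  obtain f where f: "inj_on f (\<Union>K)" and L: "L = (`) f ` K"
    using assms(1) by (auto simp: complex_iso_iff)
  have "inj_on ((`) f) K"
    using inj_on_image_Pow[OF f] by (rule inj_on_subset) blast
  then have "bij_betw ((`) f) (topspace (face_space K)) (topspace (face_space L))"
    by (simp add: L bij_betw_def)
  moreover have "f ` S \<subseteq> f ` T \<longleftrightarrow> S \<subseteq> T" if "S \<in> K" "T \<in> K" for S T
    using that by (intro inj_on_image_subset_iff[OF f]) auto
  then have "point_le (face_space L) (f ` S) (f ` T) \<longleftrightarrow> point_le (face_space K) S T"
    if "S \<in> K" "T \<in> K" for S T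
    using that by (simp add: L point_le_face_space)
  moreover have "finite_complex L"
    using finite_complex_image[OF assms(2)] L by simp
  ultimately show ?thesis
    using finite_t0_space_face_space[OF assms(2)] finite_t0_space_face_space[of L]
    by (intro order_iso_imp_homeomorphic_space[where f = "(`) f"]) auto
qed

lemma face_space_same_simple_homotopy_type:
  assumes "same_simple_homotopy_type K L"
  shows "simply_equivalent (face_space K) (face_space L)"
proof -
  obtain K' L' :: "nat set set"
    where KL: "complex_iso K K'" "complex_step\<^sup>*\<^sup>* K' L'" "complex_iso L' L"
    and K: "finite_complex K"
    using assms by (auto simp: same_simple_homotopy_type_def)
  have K': "finite_complex K'"
    using KL(1) K finite_complex_image by (auto simp: complex_iso_iff)
  have steps: "simply_equivalent (face_space A) (face_space B)"
    if "complex_step A B" for A B :: "nat set set"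
    using that face_space_collapse finite_t0_space_face_space
      space_collapse_imp_simply_equivalent simply_equivalent_sym
    unfolding complex_step_def by metis
  have "finite_complex L' \<and> simply_equivalent (face_space K') (face_space L')"
    using KL(2)
  proof induction
    case base
    then show ?case
      using K' homeomorphic_space_refl homeomorphic_imp_simply_equivalent finite_t0_space_face_space
      by blast
  next
    case (step A B)
    then show ?case
      using steps simply_equivalent_trans unfolding complex_step_def by blast
  qed
  then show ?thesis
    using KL K face_space_iso homeomorphic_imp_simply_equivalent
      finite_t0_space_face_space simply_equivalent_trans by meson
qed

section \<open>Comparison with the face poset of the order complex\<close>

text \<open>The mapping cylinder of the map sending a chain to its maximum.\<close>

definition cylinder_le :: "'a topology \<Rightarrow> 'a set + 'a \<Rightarrow> 'a set + 'a \<Rightarrow> bool" where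
  "cylinder_le X p q = (case p of
      Inl C \<Rightarrow> (case q of Inl D \<Rightarrow> C \<subseteq> D | Inr x \<Rightarrow> \<forall>c\<in>C. point_le X c x)
    | Inr y \<Rightarrow> (case q of Inl D \<Rightarrow> False | Inr x \<Rightarrow> point_le X y x))"

definition cylinder_points :: "'a topology \<Rightarrow> ('a set + 'a) set" where
  "cylinder_points X = Inl ` order_complex X \<union> Inr ` topspace X"

definition cylinder :: "'a topology \<Rightarrow> ('a set + 'a) topology" where
  "cylinder X = down_topology (cylinder_points X) (cylinder_le X)"

lemma cylinder_le_simps [simp]:
  "cylinder_le X (Inl C) (Inl D) \<longleftrightarrow> C \<subseteq> D"
  "cylinder_le X (Inl C) (Inr x) \<longleftrightarrow> (\<forall>c\<in>C. point_le X c x)"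
  "\<not> cylinder_le X (Inr x) (Inl C)"
  "cylinder_le X (Inr x) (Inr y) \<longleftrightarrow> point_le X x y"
  by (simp_all add: cylinder_le_def)

lemma in_cylinder_points [simp]:
  "Inl C \<in> cylinder_points X \<longleftrightarrow> C \<in> order_complex X"
  "Inr x \<in> cylinder_points X \<longleftrightarrow> x \<in> topspace X"
  by (auto simp: cylinder_points_def)

lemma cylinder_points_diff:
  "cylinder_points X - Inr ` topspace X = Inl ` order_complex X"
  "cylinder_points X - Inl ` order_complex X = Inr ` topspace X"
  unfolding cylinder_points_def by blast+

lemma topspace_cylinder: "topspace (cylinder X) = cylinder_points X"
  by (simp add: cylinder_def topspace_down_topology)

lemma cylinder_le_refl: "cylinder_le X p p"
  by (cases p) (auto simp: point_le_refl)

lemma cylinder_le_trans: "cylinder_le X p q \<Longrightarrow> cylinder_le X q r \<Longrightarrow> cylinder_le X p r"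
  by (cases p; cases q; cases r) (auto intro: point_le_trans)

lemma point_le_cylinder:
  assumes "p \<in> cylinder_points X" "q \<in> cylinder_points X"
  shows "point_le (cylinder X) p q \<longleftrightarrow> cylinder_le X p q"
  unfolding cylinder_def
  by (rule point_le_down_topology[OF assms cylinder_le_refl]) (rule cylinder_le_trans)

lemma subset_if_in_order_complex: "C \<in> order_complex X \<Longrightarrow> C \<subseteq> topspace X"
  by (simp add: order_complex_def)

lemma finite_t0_space_cylinder:
  assumes X: "finite_t0_space X"
  shows "finite_t0_space (cylinder X)"
proof (rule finite_t0_space_if_antisym)
  show "finite (topspace (cylinder X))"
    using finite_complexD(1)[OF finite_complex_order_complex[OF X]] finite_t0_spaceD(1)[OF X]
    by (simp add: topspace_cylinder cylinder_points_def)
next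
  fix p q assume "p \<in> topspace (cylinder X)" "q \<in> topspace (cylinder X)"
    and "point_le (cylinder X) p q" "point_le (cylinder X) q p"
  then have "p \<in> cylinder_points X" "q \<in> cylinder_points X" "cylinder_le X p q" "cylinder_le X q p"
    by (simp_all add: topspace_cylinder point_le_cylinder)
  then show "p = q"
    using point_le_antisym[OF X] by (cases p; cases q) (auto simp: cylinder_points_def)
qed

text \<open>The points of \<open>X\<close> are removed from the bottom up. When no remaining point
  of \<open>X\<close> lies below \<open>x\<close>, only the chains bounded by \<open>x\<close> do,
  and the inclusions of \<open>C\<close> and \<open>{x}\<close> in \<open>insert x C\<close> make
  them conical.\<close>

lemma cylinder_collapse_left:
  fixes X :: "'a topology"
  assumes X: "finite_t0_space X"
  shows "space_collapse (cylinder X) (subtopology (cylinder X) (Inl ` order_complex X))"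
proof -
  let ?Z = "cylinder X" and ?K = "order_complex X"
  note Z = finite_t0_space_cylinder[OF X]
  have "space_collapse ?Z (subtopology ?Z (topspace ?Z - Inr ` topspace X))"
  proof (rule space_collapse_remove_set[OF Z])
    show "Inr ` topspace X \<subseteq> topspace ?Z"
      by (auto simp: topspace_cylinder)
  next
    fix S :: "('a set + 'a) set" assume S: "S \<subseteq> Inr ` topspace X" "S \<noteq> {}"
    let ?T = "topspace ?Z - Inr ` topspace X \<union> S"
    have T: "?T = Inl ` ?K \<union> S"
      unfolding topspace_cylinder cylinder_points_diff ..
    have SZ: "S \<subseteq> topspace ?Z"
      using S(1) by (auto simp: topspace_cylinder)
    obtain p where p: "p \<in> S" "\<And>q. q \<in> S \<Longrightarrow> point_le ?Z q p \<Longrightarrow> q = p"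
      by (rule exists_minimal_point[OF Z SZ S(2)]) blast
    then obtain x where x: "p = Inr x" "x \<in> topspace X"
      using S(1) by blast
    have TA: "?T \<subseteq> cylinder_points X"
      unfolding T using S(1) by auto
    let ?W = "{q \<in> ?T. q \<noteq> p \<and> point_le ?Z q p}"
    have W: "?W = Inl ` {C \<in> ?K. \<forall>c\<in>C. point_le X c x}"
    proof (intro equalityI subsetI)
      fix q assume q: "q \<in> ?W"
      then have "q \<notin> S"
        using p(2) by blast
      then obtain C where C: "q = Inl C" "C \<in> ?K"
        using q unfolding T by blast
      moreover have "cylinder_le X q p"
        using q C point_le_cylinder[of q X p] x by auto
      ultimately show "q \<in> Inl ` {C \<in> ?K. \<forall>c\<in>C. point_le X c x}"
        using x by auto
    next
      fix q :: "'a set + 'a" assume "q \<in> Inl ` {C \<in> ?K. \<forall>c\<in>C. point_le X c x}"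
      then obtain C where C: "q = Inl C" "C \<in> ?K" "\<forall>c\<in>C. point_le X c x"
        by blast
      then have "point_le ?Z q p"
        using point_le_cylinder[of q X p] x by auto
      then show "q \<in> ?W"
        using C x unfolding T by blast
    qed
    \<comment> \<open>Every point of \<open>?W\<close> has the form \<open>Inl C\<close>, so
      \<open>projl\<close> just reads off the chain.\<close>
    let ?f = "\<lambda>q. Inl (insert x (projl q)) :: 'a set + 'a"
    have ins: "insert x C \<in> ?K" if "C \<in> ?K" "\<forall>c\<in>C. point_le X c x" for C
      using that x(2) by (auto simp: order_complex_def chain_def point_le_refl)
    have x1: "Inl {x} \<in> ?W"
      unfolding W using x(2) by (auto simp: order_complex_def chain_def point_le_refl)
    have fW: "?f q \<in> ?W" if "q \<in> ?W" for q
      using that ins point_le_refl[of X x] unfolding W by auto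
    have pW: "point_le ?Z q q' \<longleftrightarrow> projl q \<subseteq> projl q'" if "q \<in> ?W" "q' \<in> ?W" for q q'
    proof -
      have "q \<in> cylinder_points X" "q' \<in> cylinder_points X"
        using that unfolding W by auto
      then show ?thesis
        using that point_le_cylinder[of q X q'] unfolding W by auto
    qed
    have "weak_point (subtopology ?Z ?T) p"
    proof (rule weak_point_if_conical_lower[OF Z _ _ refl, of _ _ "Inl {x}" ?f])
      show "?T \<subseteq> topspace ?Z"
        unfolding topspace_cylinder using TA[unfolded topspace_cylinder] .
      show "point_le ?Z (?f q) (?f q')" if "q \<in> ?W" "q' \<in> ?W" "point_le ?Z q q'" for q q'
        unfolding pW[OF fW[OF that(1)] fW[OF that(2)]] using that(3)[unfolded pW[OF that(1,2)]] by auto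
      show "point_le ?Z q (?f q) \<and> point_le ?Z (Inl {x}) (?f q)" if "q \<in> ?W" for q
        unfolding pW[OF that fW[OF that]] pW[OF x1 fW[OF that]] by auto
    qed (use p(1) x1 fW in blast)+
    then show "\<exists>p\<in>S. weak_point (subtopology ?Z ?T) p"
      using p(1) by blast
  qed
  then show ?thesis
    unfolding topspace_cylinder cylinder_points_diff .
qed

text \<open>The chains are removed from the top down. Above a chain that is maximal among the
  remaining ones there are only points of \<open>X\<close>, namely its upper bounds, and the maximum
  of the chain is the least of these.\<close>

lemma cylinder_collapse_right:
  fixes X :: "'a topology"
  assumes X: "finite_t0_space X"
  shows "space_collapse (cylinder X) (subtopology (cylinder X) (Inr ` topspace X))"
proof -
  let ?Z = "cylinder X" and ?K = "order_complex X"
  note Z = finite_t0_space_cylinder[OF X]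
  note K = finite_complex_order_complex[OF X]
  have "space_collapse ?Z (subtopology ?Z (topspace ?Z - Inl ` ?K))"
  proof (rule space_collapse_remove_set[OF Z])
    show "Inl ` ?K \<subseteq> topspace ?Z"
      by (auto simp: topspace_cylinder)
  next
    fix S :: "('a set + 'a) set" assume S: "S \<subseteq> Inl ` ?K" "S \<noteq> {}"
    let ?T = "topspace ?Z - Inl ` ?K \<union> S"
    have T: "?T = Inr ` topspace X \<union> S"
      unfolding topspace_cylinder cylinder_points_diff ..
    have SZ: "S \<subseteq> topspace ?Z"
      using S(1) by (auto simp: topspace_cylinder)
    obtain p where p: "p \<in> S" "\<And>q. q \<in> S \<Longrightarrow> point_le ?Z p q \<Longrightarrow> q = p"
      by (rule exists_maximal_point[OF Z SZ S(2)]) blast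
    then obtain C where C: "p = Inl C" "C \<in> ?K"
      using S(1) by blast
    have TA: "?T \<subseteq> cylinder_points X"
      unfolding T using S(1) by auto
    obtain m where m: "m \<in> C" "\<And>y. y \<in> C \<Longrightarrow> point_le X m y \<Longrightarrow> y = m"
      using exists_maximal_point[OF X subset_if_in_order_complex[OF C(2)] finite_complexD(3)[OF K C(2)]] by blast
    \<comment> \<open>In a chain a maximal point is the largest one.\<close>
    then have max: "point_le X y m" if "y \<in> C" for y
      using that C(2) by (auto simp: order_complex_def chain_def)
    have mX: "m \<in> topspace X"
      using subset_if_in_order_complex[OF C(2)] m(1) by blast
    have "weak_point (subtopology ?Z ?T) p"
    proof (rule weak_point_if_upper_least[OF Z, of _ _ "Inr m"])
      show "?T \<subseteq> topspace ?Z"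
        unfolding topspace_cylinder using TA[unfolded topspace_cylinder] .
      show "p \<in> ?T" "Inr m \<in> ?T"
        unfolding T using p(1) mX by auto
      show "Inr m \<noteq> p"
        using C by simp
      show "point_le ?Z p (Inr m)"
        using point_le_cylinder[of p X "Inr m"] C mX max by auto
    next
      fix q assume q: "q \<in> ?T" "q \<noteq> p" "point_le ?Z p q"
      then have "q \<notin> S"
        using p(2) by blast
      then obtain y where y: "q = Inr y" "y \<in> topspace X"
        using q(1) unfolding T by blast
      have "cylinder_le X p q"
        using q(3) point_le_cylinder[of p X q] C y by auto
      then have "cylinder_le X (Inr m) q"
        using C y m(1) by simp
      then show "point_le ?Z (Inr m) q"
        using point_le_cylinder[of "Inr m" X q] y mX by auto
    qed
    then show "\<exists>p\<in>S. weak_point (subtopology ?Z ?T) p"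
      using p(1) by blast
  qed
  then show ?thesis
    unfolding topspace_cylinder cylinder_points_diff .
qed

lemma simply_equivalent_subdivision:
  assumes X: "finite_t0_space X"
  shows "simply_equivalent X (face_space (order_complex X))"
proof -
  let ?Z = "cylinder X" and ?K = "order_complex X"
  note Z = finite_t0_space_cylinder[OF X]
  note K = finite_complex_order_complex[OF X]
  have 1: "simply_equivalent ?Z (subtopology ?Z (Inl ` ?K))"
    using space_collapse_imp_simply_equivalent[OF cylinder_collapse_left[OF X] Z] .
  have 2: "simply_equivalent ?Z (subtopology ?Z (Inr ` topspace X))"
    using space_collapse_imp_simply_equivalent[OF cylinder_collapse_right[OF X] Z] .
  have pS: "point_le (subtopology ?Z T) p q \<longleftrightarrow> cylinder_le X p q" if "T \<subseteq> cylinder_points X" "p \<in> T" "q \<in> T" for T p q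
  proof -
    have "p \<in> topspace ?Z \<inter> T" "q \<in> topspace ?Z \<inter> T" "p \<in> cylinder_points X" "q \<in> cylinder_points X"
      using that by (auto simp: topspace_cylinder)
    then show ?thesis
      using point_le_subtopology[OF Z, of p T q] point_le_cylinder[of p X q] by simp
  qed
  have topS: "topspace (subtopology ?Z T) = T" if "T \<subseteq> cylinder_points X" for T
    using that by (auto simp: topspace_cylinder)
  have "face_space ?K homeomorphic_space subtopology ?Z (Inl ` ?K)"
  proof (rule order_iso_imp_homeomorphic_space)
    show "bij_betw Inl (topspace (face_space ?K)) (topspace (subtopology ?Z (Inl ` ?K)))"
      by (subst topS) (auto simp: bij_betw_def)
    show "point_le (subtopology ?Z (Inl ` ?K)) (Inl C) (Inl D) \<longleftrightarrow> point_le (face_space ?K) C D"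
      if "C \<in> topspace (face_space ?K)" "D \<in> topspace (face_space ?K)" for C D
      using that by (subst pS) (auto simp: point_le_face_space)
  qed (intro finite_t0_space_face_space finite_t0_space_subtopology K Z)+
  then have "simply_equivalent (face_space ?K) (subtopology ?Z (Inl ` ?K))"
    using finite_t0_space_face_space[OF K] homeomorphic_imp_simply_equivalent by blast
  moreover have "X homeomorphic_space subtopology ?Z (Inr ` topspace X)"
  proof (rule order_iso_imp_homeomorphic_space)
    show "bij_betw Inr (topspace X) (topspace (subtopology ?Z (Inr ` topspace X)))"
      by (subst topS) (auto simp: bij_betw_def)
    show "point_le (subtopology ?Z (Inr ` topspace X)) (Inr x) (Inr y) \<longleftrightarrow> point_le X x y"
      if "x \<in> topspace X" "y \<in> topspace X" for x y
      using that by (subst pS) auto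
  qed (intro finite_t0_space_subtopology X Z)+
  then have "simply_equivalent X (subtopology ?Z (Inr ` topspace X))"
    using X homeomorphic_imp_simply_equivalent by blast
  ultimately show ?thesis
    using 1 2 simply_equivalent_sym simply_equivalent_trans by meson
qed

section \<open>Comparison with the order complex of the face poset\<close>

text \<open>A simplicial mapping cylinder between a complex, with vertices \<open>Inl v\<close>, and its barycentric
  subdivision, with vertices \<open>Inr S\<close>. The parameters \<open>J\<close> and \<open>R\<close> restrict the simplices
  occurring on the two sides.\<close>

definition subdivision_cylinder :: "'a set set \<Rightarrow> 'a set set \<Rightarrow> ('a + 'a set) set set" where
  "subdivision_cylinder J R = {P. P \<noteq> {} \<and> (Inl -` P = {} \<or> Inl -` P \<in> J) \<and> Inr -` P \<subseteq> R \<and>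
     (\<forall>S\<in>Inr -` P. Inl -` P \<subseteq> S \<and> (\<forall>S'\<in>Inr -` P. S \<subseteq> S' \<or> S' \<subseteq> S))}"

lemma vimage_insert_Inl_Inr:
  "Inl -` insert (Inl v) P = insert v (Inl -` P)" "Inr -` insert (Inl v) P = Inr -` P"
  "Inl -` insert (Inr S) P = Inl -` P" "Inr -` insert (Inr S) P = insert S (Inr -` P)"
  by auto

lemma Inl_Inr_vimage_Un: "Inl ` (Inl -` P) \<union> Inr ` (Inr -` P) = P"
proof (rule set_eqI)
  fix p show "p \<in> Inl ` (Inl -` P) \<union> Inr ` (Inr -` P) \<longleftrightarrow> p \<in> P"
    by (cases p) auto
qed

lemma finite_complex_subdivision_cylinder:
  assumes K: "finite_complex K"
  shows "finite_complex (subdivision_cylinder K K)"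
proof -
  let ?V = "Inl ` \<Union>K \<union> Inr ` K :: ('a + 'a set) set"
  have fin: "finite ?V"
    using finite_complex_vertices[OF K] finite_complexD(1)[OF K] by simp
  have sub: "P \<subseteq> ?V" if "P \<in> subdivision_cylinder K K" for P
  proof -
    have "Inl -` P \<subseteq> \<Union>K" "Inr -` P \<subseteq> K"
      using that by (auto simp: subdivision_cylinder_def)
    then have "Inl ` (Inl -` P) \<union> Inr ` (Inr -` P) \<subseteq> ?V"
      by (intro Un_mono image_mono)
    then show ?thesis
      unfolding Inl_Inr_vimage_Un .
  qed
  have "finite_complex (Pow ?V - {{}})"
    using fin by (auto simp: finite_complex_def intro: finite_subset)
  then show ?thesis
  proof (rule finite_complex_subcomplex)
    show "subdivision_cylinder K K \<subseteq> Pow ?V - {{}}"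
    proof
      fix P assume P: "P \<in> subdivision_cylinder K K"
      then have "P \<noteq> {}"
        by (simp add: subdivision_cylinder_def)
      then show "P \<in> Pow ?V - {{}}"
        using sub[OF P] by blast
    qed
    fix P Q assume P: "P \<in> subdivision_cylinder K K" and Q: "Q \<in> Pow ?V - {{}}" "Q \<subseteq> P"
    have QP: "Inl -` Q \<subseteq> Inl -` P" "Inr -` Q \<subseteq> Inr -` P"
      using Q(2) by auto
    have QK: "Inl -` Q = {} \<or> Inl -` Q \<in> K"
    proof (cases "Inl -` Q = {}")
      case False
      then have "Inl -` P \<noteq> {}"
        using QP(1) by blast
      then have "Inl -` P \<in> K"
        using P by (simp add: subdivision_cylinder_def)
      then show ?thesis
        using finite_complexD(5)[OF K _ QP(1)] False by blast
    qed simp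
    have PP: "Inr -` P \<subseteq> K" "\<And>S. S \<in> Inr -` P \<Longrightarrow> Inl -` P \<subseteq> S"
      "\<And>S S'. S \<in> Inr -` P \<Longrightarrow> S' \<in> Inr -` P \<Longrightarrow> S \<subseteq> S' \<or> S' \<subseteq> S"
      using P by (simp_all add: subdivision_cylinder_def)
    have "Q \<noteq> {}"
      using Q(1) by simp
    moreover have "Inl -` Q \<subseteq> S \<and> (\<forall>S'\<in>Inr -` Q. S \<subseteq> S' \<or> S' \<subseteq> S)" if "S \<in> Inr -` Q" for S
      using PP(2)[of S] PP(3)[of S] QP that by (simp add: subset_iff)
    ultimately show "Q \<in> subdivision_cylinder K K"
      using QK subset_trans[OF QP(2) PP(1)] by (simp add: subdivision_cylinder_def)
  qed
qed

text \<open>The barycentres \<open>Inr S\<close> are removed with the smallest \<open>S\<close>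
  first. For \<open>S\<close> minimal in \<open>R\<close>, a simplex of the cylinder through
  \<open>Inr S\<close> has its vertex part inside \<open>S\<close> and all its barycentres at
  simplices containing \<open>S\<close>. Any vertex \<open>v\<close> of \<open>S\<close> can
  therefore be added, and the link of \<open>Inr S\<close> is a cone with apex
  \<open>Inl v\<close>.\<close>

lemma subdivision_cylinder_collapse_left:
  assumes K: "finite_complex K" and "R \<subseteq> K" and "finite_complex (subdivision_cylinder K R)"
  shows "simplicial_collapse (subdivision_cylinder K R) (subdivision_cylinder K {})"
  using finite_subset[OF assms(2) finite_complexD(1)[OF K]] assms(2,3)
proof (induction "card R" arbitrary: R)
  case (Suc n)
  then have "R \<noteq> {}"
    by auto
  then obtain S where S: "S \<in> R" and min: "\<And>S'. S' \<in> R \<Longrightarrow> S' \<subseteq> S \<Longrightarrow> S' = S"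
    using finite_has_minimal[of R] Suc.prems(1) by blast
  obtain v where v: "v \<in> S"
    using finite_complexD(3)[OF K] S Suc.prems(2) by blast
  let ?M = "subdivision_cylinder K R"
  have "insert (Inl v) P \<in> ?M" if P: "P \<in> ?M" and SP: "{Inr S} \<subseteq> P" for P
  proof -
    have "S \<subseteq> S'" if "S' \<in> Inr -` P" for S'
    proof -
      have "S' \<in> R" "S \<subseteq> S' \<or> S' \<subseteq> S"
        using P SP that by (auto simp: subdivision_cylinder_def)
      then show ?thesis
        using min by blast
    qed
    moreover have PS: "insert v (Inl -` P) \<subseteq> S"
      using P SP v by (auto simp: subdivision_cylinder_def)
    ultimately have "insert v (Inl -` P) \<subseteq> S'" if "S' \<in> Inr -` P" for S'
      using that by blast
    moreover have "insert v (Inl -` P) \<in> K"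
      using PS finite_complexD(5)[OF K, of S] S Suc.prems(2) by blast
    ultimately show ?thesis
      using P unfolding subdivision_cylinder_def by (simp add: vimage_insert_Inl_Inr)
  qed
  then have star: "simplicial_collapse ?M {P \<in> ?M. \<not> {Inr S} \<subseteq> P}"
    using Suc.prems(3) by (intro simplicial_collapse_open_star[of _ _ "Inl v"]) auto
  have eq: "{P \<in> ?M. \<not> {Inr S} \<subseteq> P} = subdivision_cylinder K (R - {S})"
    by (auto simp: subdivision_cylinder_def)
  have "finite_complex (subdivision_cylinder K (R - {S}))"
    using simplicial_collapse_finite_complex[OF star Suc.prems(3)] unfolding eq .
  then have "simplicial_collapse (subdivision_cylinder K (R - {S})) (subdivision_cylinder K {})"
    using Suc S by (intro Suc.hyps(1)) auto
  then show ?case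
    by (rule simplicial_collapse_trans[OF star[unfolded eq]])
qed (simp add: simplicial_collapse_def)

text \<open>The simplices of \<open>J\<close> are removed with the largest first. For
  \<open>T\<close> maximal in \<open>J\<close>, a simplex of the cylinder containing the vertices of
  \<open>T\<close> has vertex part exactly \<open>T\<close>, and all its barycentres are at
  simplices containing \<open>T\<close>. The barycentre \<open>Inr T\<close> can therefore be added,
  and the link of \<open>Inl\<close> applied to \<open>T\<close> is a cone with that apex.\<close>

lemma subdivision_cylinder_collapse_right:
  assumes K: "finite_complex K" and "J \<subseteq> K" and "finite_complex (subdivision_cylinder J K)"
  shows "simplicial_collapse (subdivision_cylinder J K) (subdivision_cylinder {} K)"
  using finite_subset[OF assms(2) finite_complexD(1)[OF K]] assms(2,3)
proof (induction "card J" arbitrary: J)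
  case (Suc n)
  then have "J \<noteq> {}"
    by auto
  then obtain T where T: "T \<in> J" and max: "\<And>T'. T' \<in> J \<Longrightarrow> T \<subseteq> T' \<Longrightarrow> T' = T"
    using finite_has_maximal[of J] Suc.prems(1) by blast
  have TK: "T \<in> K" "T \<noteq> {}"
    using finite_complexD(3)[OF K] T Suc.prems(2) by auto
  let ?M = "subdivision_cylinder J K"
  have TP: "Inl -` P = T" if P: "P \<in> ?M" "Inl ` T \<subseteq> P" for P
  proof -
    have "T \<subseteq> Inl -` P"
      using P(2) by blast
    moreover have "Inl -` P \<in> J"
      using P calculation TK(2) by (auto simp: subdivision_cylinder_def)
    ultimately show ?thesis
      using max by blast
  qed
  have "insert (Inr T) P \<in> ?M" if P: "P \<in> ?M" "Inl ` T \<subseteq> P" for P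
  proof -
    have "T \<subseteq> S" if "S \<in> Inr -` P" for S
      using P(1) TP[OF P] that by (auto simp: subdivision_cylinder_def)
    then show ?thesis
      using P(1) TP[OF P] T TK unfolding subdivision_cylinder_def
      by (simp add: vimage_insert_Inl_Inr)
  qed
  then have star: "simplicial_collapse ?M {P \<in> ?M. \<not> Inl ` T \<subseteq> P}"
    using Suc.prems(3) TK(2) by (intro simplicial_collapse_open_star[of _ _ "Inr T"]) auto
  have "Inl -` P = T \<longleftrightarrow> Inl ` T \<subseteq> P" if "P \<in> ?M" for P
    using TP[OF that] by blast
  then have "{P \<in> ?M. \<not> Inl ` T \<subseteq> P} = {P \<in> ?M. Inl -` P \<noteq> T}"
    by blast
  also have "\<dots> = subdivision_cylinder (J - {T}) K"
    using TK(2) by (auto simp: subdivision_cylinder_def)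
  finally have eq: "{P \<in> ?M. \<not> Inl ` T \<subseteq> P} = subdivision_cylinder (J - {T}) K" .
  have "finite_complex (subdivision_cylinder (J - {T}) K)"
    using simplicial_collapse_finite_complex[OF star Suc.prems(3)] unfolding eq .
  then have "simplicial_collapse (subdivision_cylinder (J - {T}) K) (subdivision_cylinder {} K)"
    using Suc T by (intro Suc.hyps(1)) auto
  then show ?case
    by (rule simplicial_collapse_trans[OF star[unfolded eq]])
qed (simp add: simplicial_collapse_def)

lemma same_simple_homotopy_type_subdivision:
  fixes K :: "'a set set"
  assumes K: "finite_complex K"
  shows "same_simple_homotopy_type K (order_complex (face_space K))"
proof -
  let ?M = "subdivision_cylinder K K"
  note M = finite_complex_subdivision_cylinder[OF K]
  have left: "subdivision_cylinder K {} = (`) (Inl :: _ \<Rightarrow> _ + 'a set) ` K"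
  proof (intro equalityI subsetI)
    fix P assume "P \<in> subdivision_cylinder K {}"
    then have P: "P \<noteq> {}" "Inl -` P = {} \<or> Inl -` P \<in> K" "Inr -` P = {}"
      by (auto simp: subdivision_cylinder_def)
    then have "P = Inl ` (Inl -` P)"
      using Inl_Inr_vimage_Un[of P] by auto
    then show "P \<in> (`) Inl ` K"
      using P(1,2) by (metis image_empty imageI)
  next
    fix P :: "('a + 'a set) set" assume "P \<in> (`) Inl ` K"
    then obtain S where S: "P = Inl ` S" "S \<in> K"
      by blast
    then have "Inl -` P = S" "Inr -` P = {}" "P \<noteq> {}"
      using finite_complexD(3)[OF K] by auto
    then show "P \<in> subdivision_cylinder K {}"
      using S(2) by (simp add: subdivision_cylinder_def)
  qed
  have oc: "C \<in> order_complex (face_space K) \<longleftrightarrow>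
      C \<subseteq> K \<and> C \<noteq> {} \<and> (\<forall>S\<in>C. \<forall>S'\<in>C. S \<subseteq> S' \<or> S' \<subseteq> S)" for C
  proof (cases "C \<subseteq> K")
    case True
    then have "point_le (face_space K) S S' \<longleftrightarrow> S \<subseteq> S'" if "S \<in> C" "S' \<in> C" for S S'
      using that point_le_face_space[of S K S'] by blast
    then show ?thesis
      by (simp add: order_complex_def chain_def)
  qed (simp add: order_complex_def)
  have right: "subdivision_cylinder {} K = (`) (Inr :: _ \<Rightarrow> 'a + _) ` order_complex (face_space K)"
  proof (intro equalityI subsetI)
    fix P assume "P \<in> subdivision_cylinder {} K"
    then have P: "P \<noteq> {}" "Inl -` P = {}" "Inr -` P \<subseteq> K"
      "\<forall>S\<in>Inr -` P. \<forall>S'\<in>Inr -` P. S \<subseteq> S' \<or> S' \<subseteq> S"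
      by (simp_all add: subdivision_cylinder_def)
    then have eq: "P = Inr ` (Inr -` P)"
      using Inl_Inr_vimage_Un[of P] by auto
    then have "Inr -` P \<in> order_complex (face_space K)"
      unfolding oc using P by (metis image_empty)
    then show "P \<in> (`) Inr ` order_complex (face_space K)"
      using eq by blast
  next
    fix P :: "('a + 'a set) set" assume "P \<in> (`) Inr ` order_complex (face_space K)"
    then obtain C where C: "P = Inr ` C" "C \<in> order_complex (face_space K)"
      by blast
    then have "Inr -` P = C" "Inl -` P = {}" "P \<noteq> {}"
      unfolding oc by auto
    then show "P \<in> subdivision_cylinder {} K"
      using C(2) unfolding oc by (simp add: subdivision_cylinder_def)
  qed
  have "complex_iso K ((`) Inl ` K :: ('a + 'a set) set set)"
    and "complex_iso (order_complex (face_space K)) ((`) Inr ` order_complex (face_space K) :: ('a + 'a set) set set)"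
    by (simp_all add: complex_iso_image)
  then have "same_simple_homotopy_type K (subdivision_cylinder K {})"
    and "same_simple_homotopy_type (order_complex (face_space K)) (subdivision_cylinder {} K)"
    unfolding left right
    using K finite_complex_order_complex[OF finite_t0_space_face_space[OF K]]
      complex_iso_imp_same_simple_homotopy_type by blast+
  moreover have "same_simple_homotopy_type ?M (subdivision_cylinder K {})"
    "same_simple_homotopy_type ?M (subdivision_cylinder {} K)"
    using subdivision_cylinder_collapse_left[OF K subset_refl M]
      subdivision_cylinder_collapse_right[OF K subset_refl M]
      M simplicial_collapse_imp_same_simple_homotopy_type by blast+
  ultimately show ?thesis
    using same_simple_homotopy_type_sym same_simple_homotopy_type_trans by meson
qed

section \<open>The correspondence of classes\<close>

lemma space_class_eq:
  assumes "simply_equivalent X Y"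
  shows "space_class X = space_class Y"
proof -
  have "simply_equivalent X Z \<longleftrightarrow> simply_equivalent Y Z" for Z :: "nat topology"
    using simply_equivalent_trans[OF assms, of Z]
      simply_equivalent_trans[OF simply_equivalent_sym[OF assms], of Z] by blast
  then show ?thesis
    by (simp add: space_class_def)
qed

lemma complex_class_eq:
  assumes "same_simple_homotopy_type K L"
  shows "complex_class K = complex_class L"
proof -
  have "same_simple_homotopy_type K M \<longleftrightarrow> same_simple_homotopy_type L M" for M :: "nat set set"
    using same_simple_homotopy_type_trans[OF assms, of M]
      same_simple_homotopy_type_trans[OF same_simple_homotopy_type_sym[OF assms], of M] by blast
  then show ?thesis
    by (simp add: complex_class_def)
qed

section \<open>Maps on classes through chosen representatives\<close>

lemma exists_in_space_class:
  assumes "finite_t0_space X"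
  obtains Y where "Y \<in> space_class X"
proof -
  obtain Y :: "nat topology" where "X homeomorphic_space Y"
    using exists_nat_space[OF assms] .
  then have "Y \<in> space_class X"
    using homeomorphic_imp_simply_equivalent[OF _ assms] by (simp add: space_class_def)
  then show ?thesis
    by (rule that)
qed

lemma exists_in_complex_class:
  assumes "finite_complex K"
  obtains L where "L \<in> complex_class K"
proof -
  obtain L :: "nat set set" where "complex_iso K L"
    using exists_nat_complex[OF assms] .
  then have "L \<in> complex_class K"
    using complex_iso_imp_same_simple_homotopy_type[OF _ assms] by (simp add: complex_class_def)
  then show ?thesis
    by (rule that)
qed

text \<open>The choice is meaningful because every class of a finite T0-space has a member on the
  natural numbers (\<open>exists_in_space_class\<close>); that the result does not depend on it is
  \<open>class_order_complex_eq\<close>.\<close>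

definition class_order_complex :: "nat topology set \<Rightarrow> nat set set set" where
  "class_order_complex c = complex_class (order_complex (SOME X. X \<in> c))"

definition class_face_space :: "nat set set set \<Rightarrow> nat topology set" where
  "class_face_space d = space_class (face_space (SOME K. K \<in> d))"

text \<open>This is well-definedness: the chosen member is simply equivalent to \<open>X\<close>,
  and order complexes of simply equivalent spaces have the same simple homotopy type. The point type
  of \<open>X\<close> is arbitrary.\<close>

lemma class_order_complex_eq:
  assumes "finite_t0_space X"
  shows "class_order_complex (space_class X) = complex_class (order_complex X)"
proof -
  obtain Y where "Y \<in> space_class X"
    using exists_in_space_class[OF assms] .
  then have "(SOME Y. Y \<in> space_class X) \<in> space_class X"
    by (rule someI)
  then have "simply_equivalent X (SOME Y. Y \<in> space_class X)"
    by (simp add: space_class_def)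
  then show ?thesis
    unfolding class_order_complex_def
    by (rule complex_class_eq[OF order_complex_simply_equivalent, symmetric])
qed

lemma class_face_space_eq:
  assumes "finite_complex K"
  shows "class_face_space (complex_class K) = space_class (face_space K)"
proof -
  obtain L where "L \<in> complex_class K"
    using exists_in_complex_class[OF assms] .
  then have "(SOME L. L \<in> complex_class K) \<in> complex_class K"
    by (rule someI)
  then have "same_simple_homotopy_type K (SOME L. L \<in> complex_class K)"
    by (simp add: complex_class_def)
  then show ?thesis
    unfolding class_face_space_def
    by (rule space_class_eq[OF face_space_same_simple_homotopy_type, symmetric])
qed

lemma complex_class_in_simple_homotopy_types:
  assumes "finite_complex K"
  shows "complex_class K \<in> simple_homotopy_types"
proof -
  obtain K' :: "nat set set" where K': "complex_iso K K'" "finite_complex K'"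
    using exists_nat_complex[OF assms] .
  then have "complex_class K = complex_class K'"
    using complex_class_eq complex_iso_imp_same_simple_homotopy_type assms by blast
  then show ?thesis
    using K'(2) by (simp add: simple_homotopy_types_def)
qed

lemma space_class_in_simple_equivalence_classes:
  assumes "finite_t0_space X"
  shows "space_class X \<in> simple_equivalence_classes"
proof -
  obtain X' :: "nat topology" where X': "X homeomorphic_space X'" "finite_t0_space X'"
    using exists_nat_space[OF assms] .
  then have "space_class X = space_class X'"
    using space_class_eq homeomorphic_imp_simply_equivalent assms by blast
  then show ?thesis
    using X'(2) by (simp add: simple_equivalence_classes_def)
qed

text \<open>Types cannot be quantified under the existential quantifier. The clauses on natural
  numbers determine both maps on all classes, and the clauses with free type variables tie these
  maps to representatives over other types.\<close>

theorem corollary3p10: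
  shows "\<exists>\<Phi> \<Psi>.
    bij_betw \<Phi> simple_equivalence_classes simple_homotopy_types \<and>
    bij_betw \<Psi> simple_homotopy_types simple_equivalence_classes \<and>
    (\<forall>c \<in> simple_equivalence_classes. \<Psi> (\<Phi> c) = c) \<and>
    (\<forall>d \<in> simple_homotopy_types. \<Phi> (\<Psi> d) = d) \<and>
    (\<forall>X :: nat topology. finite_t0_space X \<longrightarrow>
        \<Phi> (space_class X) = complex_class (order_complex X)) \<and>
    (\<forall>K :: nat set set. finite_complex K \<longrightarrow>
        \<Psi> (complex_class K) = space_class (face_space K)) \<and>
    (\<forall>X :: 'a topology. finite_t0_space X \<longrightarrow>
        \<Phi> (space_class X) = complex_class (order_complex X)) \<and>
    (\<forall>K :: 'b set set. finite_complex K \<longrightarrow>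
        \<Psi> (complex_class K) = space_class (face_space K))"
proof -
  have face_order: "class_face_space (class_order_complex c) = c" if c: "c \<in> simple_equivalence_classes" for c
  proof -
    obtain X :: "nat topology" where X: "finite_t0_space X" "c = space_class X"
      using c by (auto simp: simple_equivalence_classes_def)
    then show ?thesis
      using finite_complex_order_complex[OF X(1)] space_class_eq[OF simply_equivalent_subdivision[OF X(1)], symmetric]
      by (simp add: class_order_complex_eq class_face_space_eq)
  qed
  have order_face: "class_order_complex (class_face_space d) = d" if d: "d \<in> simple_homotopy_types" for d
  proof -
    obtain K :: "nat set set" where K: "finite_complex K" "d = complex_class K"
      using d by (auto simp: simple_homotopy_types_def)
    then show ?thesis
      using finite_t0_space_face_space[OF K(1)]
        complex_class_eq[OF same_simple_homotopy_type_subdivision[OF K(1)], symmetric]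
      by (simp add: class_order_complex_eq class_face_space_eq)
  qed
  have order: "class_order_complex c \<in> simple_homotopy_types" if c: "c \<in> simple_equivalence_classes" for c
    using c complex_class_in_simple_homotopy_types[OF finite_complex_order_complex]
    by (auto simp: simple_equivalence_classes_def class_order_complex_eq)
  have face: "class_face_space d \<in> simple_equivalence_classes" if d: "d \<in> simple_homotopy_types" for d
    using d space_class_in_simple_equivalence_classes[OF finite_t0_space_face_space]
    by (auto simp: simple_homotopy_types_def class_face_space_eq)
  have "bij_betw class_order_complex simple_equivalence_classes simple_homotopy_types"
    by (rule bij_betw_byWitness[where f' = class_face_space]) (use face_order order_face order face in auto)
  moreover have "bij_betw class_face_space simple_homotopy_types simple_equivalence_classes"
    by (rule bij_betw_byWitness[where f' = class_order_complex]) (use face_order order_face order face in auto)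
  ultimately show ?thesis
    using face_order order_face
    by (intro exI[of _ class_order_complex] exI[of _ class_face_space])
      (simp add: class_order_complex_eq class_face_space_eq)
qed

end
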